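(* Let the coding system be any one of $\mathsf{K}_1$, $\mathsf{K}_2$, $\mathsf{KV}$. Then $\mathsf{Fin}$ is not $\Sigma^0_2$-complete, i.e. not every $\Sigma^0_2$ subobject of $\omega^\omega$ is many-one reducible to $\mathsf{Fin}$; indeed, $\mathsf{L}\not\leq_{\sf m}\mathsf{Fin}$.
   Context: Coding systems. $\mathsf{K}_1$: $\mathtt{Code}=\omega$, and the (partial) realizable functions are the partial computable functions on $\omega$. $\mathsf{K}_2$: $\mathtt{Code}=\omega^\omega$, and the realizable functions are the partial continuous functions $x\mapsto p\ast x$ ($p\in\omega^\omega$), where $\ast$ is application in Kleene's second algebra. $\mathsf{KV}$: $\mathtt{Code}=\omega^\omega$ with the same application, and the realizable functions are the partial computable ones (those $x\mapsto p\ast x$ with $p$ computable). Fix one of them; $\langle\cdot,\cdot\rangle$ is a standard computable tupling on $\mathtt{Code}$. A represented space $X$ is a set $|X|$ with a partial surjection $\delta_X$ from $\mathtt{Code}$ onto $|X|$; $p$ is an $X$-name of $x$ if $\delta_X(p)=x$. A morphism $f\colon X\to Y$ is a function $|X|\to|Y|$ for which some partial realizable function sends every $X$-name of $x$ to a $Y$-name of $f(x)$. Names of elements of finite products are tuples of names. In $\mathsf{K}_1$, $n\in\omega$ has name $n$, and $\omega^\omega$ consists of the total computable functions, a name being any index; in $\mathsf{K}_2,\mathsf{KV}$, $n\in\omega$ has name $n0^\infty$, and $\omega^\omega$ consists of all functions, each named by itself. A subobject $A$ of $X$ is a represented space with $|A|\subseteq|X|$ such that some partial realizable function sends every $A$-name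 of $x\in|A|$ to an $X$-name of $x$. It is a subspace if moreover $A$-names and $X$-names of each $x\in|A|$ coincide. For subobjects $A,B$ of $X$, $A\subseteq B$ means $|A|\subseteq|B|$ and the inclusion $A\to B$ is a morphism; $A\equiv B$ means $A\subseteq B$ and $B\subseteq A$. Many-one reducibility: for subobjects $A$ of $X$ and $B$ of $Y$, $A\leq_{\sf m}B$ if there are a morphism $\varphi\colon X\to Y$ and partial realizable functions $r_-,r_+$ with: (1) for all $x\in|X|$, $x\in|A|\iff\varphi(x)\in|B|$; (2) if $p$ is an $A$-name of $x\in|A|$ then $r_-(p)$ is a $B$-name of $\varphi(x)$; (3) if $p$ is an $X$-name of $x\in|A|$ and $q$ is a $B$-name of $\varphi(x)$ then $r_+(p,q)$ is an $A$-name of $x$. A uniformly $\Pi^0_1$ sequence of subobjects of $\omega^\omega$ is a sequence $(B_n)_{n\in\omega}$ for which there is a morphism $f\colon\omega\times\omega^\omega\times\omega\to\omega$ such that $B_n$ is (equivalent, uniformly in $n$, to) the subspace $\{x:\forall k\; f(n,x,k)=0\}$. The witnessed union $\biguplus_nB_n$ has underlying set $\bigcup_n|B_n|$, and $\langle u,p\rangle$ is a name of $x$ in it iff $u$ is a name of some $n\in\omega$ and $p$ is a name of $x\in B_n$. A subobject $A$ of $\omega^\omega$ is $\Sigma^0_2$ if $A\equiv\biguplus_nB_n$ for some uniformly $\Pi^0_1$ sequence $(B_n)$. $\mathsf{Fin}$ is the subobject of $\omega^\omega$ with $|\mathsf{Fin}|=\{x:\exists n\,\forall m\geq n\; x(m)=0\}$;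 a name of $x\in\mathsf{Fin}$ is a pair $\langle n,p\rangle$ with $p$ an $\omega^\omega$-name of $x$ and $x(m)=0$ for all $m\geq n$. $\mathsf{L}$ is the subobject of $\omega^\omega\times\omega^\omega$ (identified with $\omega^\omega$ via a standard pairing) with underlying set $\{(x,y):x=0^\infty\text{ or }y=0^\infty\}$; $\langle i,p\rangle$ is a name of $(x,y)\in\mathsf{L}$ iff $p$ is a name of $(x,y)$ and, if $i=0$, then $x=0^\infty$, and otherwise $y=0^\infty$. *)

theory Defs
  imports Main "HOL-Library.Nat_Bijection"
begin

section \<open>Partial computable functions\<close>

text \<open>
  The partial recursive functions on the natural numbers, as the least class of unary partial
  functions closed under the usual schemes; several arguments are passed through the Cantor pairing
  \<^const>\<open>prod_encode\<close>.
\<close>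

datatype prog =
    Zero | Succ | Fst | Snd
  | Pair prog prog | Comp prog prog | PrimRec prog prog | Mu prog

primrec eval :: "prog \<Rightarrow> nat \<rightharpoonup> nat" where
  "eval Zero x = Some 0"
| "eval Succ x = Some (Suc x)"
| "eval Fst x = Some (fst (prod_decode x))"
| "eval Snd x = Some (snd (prod_decode x))"
| "eval (Pair f g) x =
     Option.bind (eval f x) (\<lambda>a. Option.bind (eval g x) (\<lambda>b. Some (prod_encode (a, b))))"
| "eval (Comp f g) x = Option.bind (eval g x) (eval f)"
| "eval (PrimRec f g) x = (case prod_decode x of (a, n) \<Rightarrow>
     rec_nat (eval f a)
       (\<lambda>m r. Option.bind r (\<lambda>y. eval g (prod_encode (a, prod_encode (m, y))))) n)"
| "eval (Mu f) x =
     (if \<exists>n. eval f (prod_encode (x, n)) = Some 0 \<and>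
             (\<forall>m<n. eval f (prod_encode (x, m)) \<noteq> None)
      then Some (LEAST n. eval f (prod_encode (x, n)) = Some 0)
      else None)"

definition partial_computable :: "(nat \<rightharpoonup> nat) \<Rightarrow> bool" where
  "partial_computable f \<longleftrightarrow> (\<exists>P. f = eval P)"

definition computable :: "(nat \<Rightarrow> nat) \<Rightarrow> bool" where
  "computable f \<longleftrightarrow> partial_computable (\<lambda>n. Some (f n))"

text \<open>The Goedel numbering by which computable functions are named.\<close>

function prog_of :: "nat \<Rightarrow> prog" where
  "prog_of e =
    (if e = 0 then Zero else if e = 1 then Succ else if e = 2 then Fst else if e = 3 then Snd
     else let d = (e - 4) div 4; i = fst (prod_decode d); j = snd (prod_decode d) in
       if e mod 4 = 0 then Pair (prog_of i) (prog_of j)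
       else if e mod 4 = 1 then Comp (prog_of i) (prog_of j)
       else if e mod 4 = 2 then PrimRec (prog_of i) (prog_of j)
       else Mu (prog_of d))"
  by auto
termination
proof (relation "measure id", goal_cases)
  have fst_le: "fst (prod_decode d) \<le> d" for d
    by (metis le_prod_encode_1 prod.collapse prod_decode_inverse)
  have snd_le: "snd (prod_decode d) \<le> d" for d
    by (metis le_prod_encode_2 prod.collapse prod_decode_inverse)
  have less: "(e - 4) div 4 < e" if "e \<noteq> 0" for e :: nat
    using that by linarith
  have i: "fst (prod_decode ((e - 4) div 4)) < e" if "e \<noteq> 0" for e
    using fst_le less that le_less_trans by blast
  have j: "snd (prod_decode ((e - 4) div 4)) < e" if "e \<noteq> 0" for e
    using snd_le less that le_less_trans by blast
  { case 1 show ?case by simp }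
  { case 2 then show ?case using i by simp }
  { case 3 then show ?case using j by simp }
  { case 4 then show ?case using i by simp }
  { case 5 then show ?case using j by simp }
  { case 6 then show ?case using i by simp }
  { case 7 then show ?case using j by simp }
  { case 8 then show ?case using less by simp }
qed

declare prog_of.simps [simp del]

lemma surj_prog_of: "\<exists>e. prog_of e = P"
proof (induction P)
  case Zero
  show ?case by (rule exI [of _ 0]) (simp add: prog_of.simps)
next
  case Succ
  show ?case by (rule exI [of _ 1]) (simp add: prog_of.simps)
next
  case Fst
  show ?case by (rule exI [of _ 2]) (simp add: prog_of.simps)
next
  case Snd
  show ?case by (rule exI [of _ 3]) (simp add: prog_of.simps)
next
  case (Pair P Q)
  then obtain i j where "prog_of i = P" "prog_of j = Q" by blast
  then show ?case
    by (intro exI [of _ "4 * prod_encode (i, j) + 4"], subst prog_of.simps) (simp add: Let_def)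
next
  case (Comp P Q)
  then obtain i j where "prog_of i = P" "prog_of j = Q" by blast
  moreover have "(4 * d + 5) mod 4 = 1" "(4 * d + 5 - 4) div 4 = d" for d :: nat by presburger+
  ultimately show ?case
    by (intro exI [of _ "4 * prod_encode (i, j) + 5"], subst prog_of.simps) (simp add: Let_def)
next
  case (PrimRec P Q)
  then obtain i j where "prog_of i = P" "prog_of j = Q" by blast
  moreover have "(4 * d + 6) mod 4 = 2" "(4 * d + 6 - 4) div 4 = d" for d :: nat by presburger+
  ultimately show ?case
    by (intro exI [of _ "4 * prod_encode (i, j) + 6"], subst prog_of.simps) (simp add: Let_def)
next
  case (Mu P)
  then obtain d where "prog_of d = P" by blast
  moreover have "(4 * d + 7) mod 4 = 3" "(4 * d + 7 - 4) div 4 = d" by presburger+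
  ultimately show ?case
    by (intro exI [of _ "4 * d + 7"], subst prog_of.simps) (simp add: Let_def)
qed

definition phi :: "nat \<Rightarrow> nat \<rightharpoonup> nat" where
  "phi e = eval (prog_of e)"

lemma partial_computable_iff_index: "partial_computable f \<longleftrightarrow> (\<exists>e. f = phi e)"
  unfolding partial_computable_def phi_def by (metis surj_prog_of)


section \<open>Kleene's second algebra\<close>

text \<open>
  \<open>(p * x)(n) = p (n, x 0, ..., x (k - 1)) - 1\<close> for the least \<open>k\<close> at which the value
  of \<open>p\<close> is positive; \<open>p * x\<close> is defined iff such a \<open>k\<close> exists for every \<open>n\<close>.
\<close>

definition k2_query :: "(nat \<Rightarrow> nat) \<Rightarrow> nat \<Rightarrow> nat \<Rightarrow> nat" where
  "k2_query x n k = list_encode (n # map x [0..<k])"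

definition k2_app :: "(nat \<Rightarrow> nat) \<Rightarrow> (nat \<Rightarrow> nat) \<rightharpoonup> (nat \<Rightarrow> nat)" where
  "k2_app p x =
    (if \<forall>n. \<exists>k. p (k2_query x n k) > 0
     then Some (\<lambda>n. p (k2_query x n (LEAST k. p (k2_query x n k) > 0)) - 1)
     else None)"


section \<open>Coding systems\<close>

text \<open>
  A represented space with points in \<open>'a\<close> is its partial representation map
  \<open>'c \<rightharpoonup> 'a\<close>; as that map is onto the underlying set, the underlying set is its range.
\<close>

type_synonym ('c, 'a) rspace = "'c \<rightharpoonup> 'a"

abbreviation points :: "('c, 'a) rspace \<Rightarrow> 'a set" where
  "points X \<equiv> ran X"

text \<open>
  Tupling is given together with its two inverse projections; it is a bijection in each of the
  systems below. Longer tuples are nested to the right.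
\<close>

record 'c coding_system =
  realizable :: "('c \<rightharpoonup> 'c) \<Rightarrow> bool"
  tup :: "'c \<Rightarrow> 'c \<Rightarrow> 'c"
  tup1 :: "'c \<Rightarrow> 'c"
  tup2 :: "'c \<Rightarrow> 'c"
  omega :: "('c, nat) rspace"
  baire :: "('c, nat \<Rightarrow> nat) rspace"

definition K1 :: "nat coding_system" where
  "K1 = \<lparr>
     realizable = partial_computable,
     tup = (\<lambda>a b. prod_encode (a, b)),
     tup1 = (\<lambda>c. fst (prod_decode c)),
     tup2 = (\<lambda>c. snd (prod_decode c)),
     omega = (\<lambda>n. Some n),
     baire = (\<lambda>e. if \<forall>n. phi e n \<noteq> None then Some (\<lambda>n. the (phi e n)) else None) \<rparr>"

definition K2 :: "(nat \<Rightarrow> nat) coding_system" where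
  "K2 = \<lparr>
     realizable = (\<lambda>F. \<exists>p. F = k2_app p),
     tup = (\<lambda>a b n. if even n then a (n div 2) else b (n div 2)),
     tup1 = (\<lambda>c n. c (2 * n)),
     tup2 = (\<lambda>c n. c (2 * n + 1)),
     omega = (\<lambda>c. if \<forall>k>0. c k = 0 then Some (c 0) else None),
     baire = (\<lambda>c. Some c) \<rparr>"

definition KV :: "(nat \<Rightarrow> nat) coding_system" where
  "KV = K2\<lparr>realizable := (\<lambda>F. \<exists>p. computable p \<and> F = k2_app p)\<rparr>"

lemma tupling_K1:
  "tup1 K1 (tup K1 a b) = a" "tup2 K1 (tup K1 a b) = b" "tup K1 (tup1 K1 c) (tup2 K1 c) = c"
  by (simp_all add: K1_def)

lemma tupling_K2:
  "tup1 K2 (tup K2 a b) = a" "tup2 K2 (tup K2 a b) = b" "tup K2 (tup1 K2 c) (tup2 K2 c) = c"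
  by (auto simp: K2_def fun_eq_iff)

lemma tupling_KV:
  "tup1 KV (tup KV a b) = a" "tup2 KV (tup KV a b) = b" "tup KV (tup1 KV c) (tup2 KV c) = c"
  using tupling_K2 by (simp_all add: KV_def)


section \<open>Represented spaces, morphisms and subobjects\<close>

definition realizes ::
  "('c, 'a) rspace \<Rightarrow> ('c, 'b) rspace \<Rightarrow> ('c \<rightharpoonup> 'c) \<Rightarrow> ('a \<Rightarrow> 'b) \<Rightarrow> bool" where
  "realizes X Y F f \<longleftrightarrow>
     (\<forall>p x. X p = Some x \<longrightarrow> (\<exists>q. F p = Some q \<and> Y q = Some (f x)))"

text \<open>Only the values of \<open>f\<close> on \<open>points X\<close> matter.\<close>

definition morphism ::
  "'c coding_system \<Rightarrow> ('c, 'a) rspace \<Rightarrow> ('c, 'b) rspace \<Rightarrow> ('a \<Rightarrow> 'b) \<Rightarrow> bool" where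
  "morphism C X Y f \<longleftrightarrow>
     f ` points X \<subseteq> points Y \<and> (\<exists>F. realizable C F \<and> realizes X Y F f)"

definition prod_space ::
  "'c coding_system \<Rightarrow> ('c, 'a) rspace \<Rightarrow> ('c, 'b) rspace \<Rightarrow> ('c, 'a \<times> 'b) rspace" where
  "prod_space C X Y = (\<lambda>r.
     case (X (tup1 C r), Y (tup2 C r)) of (Some x, Some y) \<Rightarrow> Some (x, y) | _ \<Rightarrow> None)"

definition subspace :: "('c, 'a) rspace \<Rightarrow> 'a set \<Rightarrow> ('c, 'a) rspace" where
  "subspace X S = (\<lambda>p. case X p of Some x \<Rightarrow> if x \<in> S then Some x else None | None \<Rightarrow> None)"

text \<open>
  Read both as \<open>A\<close> being a subobject of the space \<open>B\<close>, and as the inclusion \<open>A \<subseteq> B\<close>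
  between subobjects of a common space.
\<close>

definition subobject :: "'c coding_system \<Rightarrow> ('c, 'a) rspace \<Rightarrow> ('c, 'a) rspace \<Rightarrow> bool" where
  "subobject C A B \<longleftrightarrow> points A \<subseteq> points B \<and> morphism C A B (\<lambda>x. x)"

definition sub_equiv :: "'c coding_system \<Rightarrow> ('c, 'a) rspace \<Rightarrow> ('c, 'a) rspace \<Rightarrow> bool" where
  "sub_equiv C A B \<longleftrightarrow> subobject C A B \<and> subobject C B A"

text \<open>\<open>A\<close> is a subobject of \<open>X\<close>, \<open>B\<close> is a subobject of \<open>Y\<close>.\<close>

definition many_one_reducible ::
  "'c coding_system \<Rightarrow> ('c, 'a) rspace \<Rightarrow> ('c, 'a) rspace \<Rightarrow>
   ('c, 'b) rspace \<Rightarrow> ('c, 'b) rspace \<Rightarrow> bool" where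
  "many_one_reducible C A X B Y \<longleftrightarrow>
     (\<exists>\<phi> rm rp. morphism C X Y \<phi> \<and> realizable C rm \<and> realizable C rp \<and>
        (\<forall>x \<in> points X. x \<in> points A \<longleftrightarrow> \<phi> x \<in> points B) \<and>
        (\<forall>p x. A p = Some x \<longrightarrow> (\<exists>q. rm p = Some q \<and> B q = Some (\<phi> x))) \<and>
        (\<forall>p q x. x \<in> points A \<longrightarrow> X p = Some x \<longrightarrow> B q = Some (\<phi> x) \<longrightarrow>
           (\<exists>s. rp (tup C p q) = Some s \<and> A s = Some x)))"


section \<open>The second level of the Borel hierarchy\<close>

text \<open>Inclusions \<open>A n \<subseteq> B n\<close>, realized uniformly in (a name of) \<open>n\<close>.\<close>

definition unif_included ::
  "'c coding_system \<Rightarrow> (nat \<Rightarrow> ('c, 'a) rspace) \<Rightarrow> (nat \<Rightarrow> ('c, 'a) rspace) \<Rightarrow> bool" where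
  "unif_included C A B \<longleftrightarrow>
     (\<exists>F. realizable C F \<and>
        (\<forall>u n p x. omega C u = Some n \<longrightarrow> A n p = Some x \<longrightarrow>
           (\<exists>q. F (tup C u p) = Some q \<and> B n q = Some x)))"

definition unif_pi01 :: "'c coding_system \<Rightarrow> (nat \<Rightarrow> ('c, nat \<Rightarrow> nat) rspace) \<Rightarrow> bool" where
  "unif_pi01 C B \<longleftrightarrow>
     (\<forall>n. subobject C (B n) (baire C)) \<and>
     (\<exists>f. morphism C (prod_space C (omega C) (prod_space C (baire C) (omega C))) (omega C) f \<and>
        (let P = (\<lambda>n. subspace (baire C) {x. \<forall>k. f (n, x, k) = 0})
         in unif_included C B P \<and> unif_included C P B))"

definition witnessed_union ::
  "'c coding_system \<Rightarrow> (nat \<Rightarrow> ('c, 'a) rspace) \<Rightarrow> ('c, 'a) rspace" where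
  "witnessed_union C B = (\<lambda>r.
     case omega C (tup1 C r) of Some n \<Rightarrow> B n (tup2 C r) | None \<Rightarrow> None)"

definition sigma02 :: "'c coding_system \<Rightarrow> ('c, nat \<Rightarrow> nat) rspace \<Rightarrow> bool" where
  "sigma02 C A \<longleftrightarrow>
     subobject C A (baire C) \<and> (\<exists>B. unif_pi01 C B \<and> sub_equiv C A (witnessed_union C B))"


section \<open>The subobjects Fin and L\<close>

definition Fin :: "'c coding_system \<Rightarrow> ('c, nat \<Rightarrow> nat) rspace" where
  "Fin C = (\<lambda>r.
     case (omega C (tup1 C r), baire C (tup2 C r)) of
       (Some n, Some x) \<Rightarrow> if \<forall>m\<ge>n. x m = 0 then Some x else None
     | _ \<Rightarrow> None)"

abbreviation baire2 :: "'c coding_system \<Rightarrow> ('c, (nat \<Rightarrow> nat) \<times> (nat \<Rightarrow> nat)) rspace" where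
  "baire2 C \<equiv> prod_space C (baire C) (baire C)"

definition L :: "'c coding_system \<Rightarrow> ('c, (nat \<Rightarrow> nat) \<times> (nat \<Rightarrow> nat)) rspace" where
  "L C = (\<lambda>r.
     case (omega C (tup1 C r), baire2 C (tup2 C r)) of
       (Some i, Some (x, y)) \<Rightarrow>
         if (if i = 0 then x = (\<lambda>_. 0) else y = (\<lambda>_. 0)) then Some (x, y) else None
     | _ \<Rightarrow> None)"

end

theory Submission
  imports Defs
begin

text \<open>
  A name of a point of \<^const>\<open>Fin\<close> carries a bound on the support of the point, and any larger number is
  as good a bound. A name of a point of \<^const>\<open>L\<close> carries a choice of a component that vanishes, and where
  both components vanish the two choices are both correct but cannot be merged. A many-one reduction
  would merge them: from the two names of a point at which both choices are correct it yields two
  bounds, both of which are dominated by one number \<open>N\<close>, and translating back the name with bound \<open>N\<close> must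
  select one of the components. As this selection is made from partial information, it can be
  spoilt by making the selected component nonzero afterwards. The other choice remains correct for
  the altered point and keeps yielding a bound that \<open>N\<close> dominates, so the name with bound \<open>N\<close> remains
  valid and the selection has to be correct, which it is not.

  In the second Kleene algebra, partial information means a finite part of a name, and the argument is
  one about continuity at the origin (\<open>not_reducible_Fin_K2\<close>). It covers the systems with continuous
  and with computable realizers, since the spaces agree and the latter has fewer realizers. In
  the first Kleene algebra a name is an index, the bounds depend on the index, and continuity is not
  available. There the point is altered through self-reference (\<open>not_reducible_Fin_K1\<close>): its components
  record the halting behaviour of a program that computes the selection for that very point.

  For the failure of completeness, \<^const>\<open>L\<close> is moved into Baire space as the witnessed union
  \<open>coded_L\<close> of a uniform sequence with two distinct members, and both irreducibility lemmas are stated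
  so as to apply to it as well. That it belongs to the second level amounts to computing \<open>x (k)\<close>
  from \<open>x\<close> and \<open>k\<close>. For functions given by an index this is the universal partial computable function,
  which is constructed here from a stack machine (\<open>partial_computable_phi\<close>). The decidable
  approximations to its graph (\<open>phi_eq_Some_iff\<close>) also provide the self-referential points.
\<close>

section \<open>Closure properties of the computable functions\<close>

abbreviation code_pair :: "nat \<Rightarrow> nat \<Rightarrow> nat" where
  "code_pair a b \<equiv> prod_encode (a, b)"

abbreviation left :: "nat \<Rightarrow> nat" where
  "left c \<equiv> fst (prod_decode c)"

abbreviation right :: "nat \<Rightarrow> nat" where
  "right c \<equiv> snd (prod_decode c)"

abbreviation Ident :: prog where
  "Ident \<equiv> Pair Fst Snd"

text \<open>
  The closure rules below are phrased with the computed function under the binder, so that a goal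
  \<open>computable (\<lambda>x. t x)\<close> is solved by resolution along the structure of \<open>t\<close>.
\<close>

lemma computable_program: "computable f \<Longrightarrow> \<exists>P. \<forall>x. eval P x = Some (f x)"
  unfolding computable_def partial_computable_def by metis

lemma computableI: "(\<And>x. eval P x = Some (f x)) \<Longrightarrow> computable f"
  unfolding computable_def partial_computable_def by (auto intro!: exI[of _ P])

lemma computable_const: "computable (\<lambda>x. k)"
proof (induction k)
  case 0
  show ?case by (rule computableI[of Zero]) simp
next
  case (Suc k)
  then obtain P where "\<forall>x. eval P x = Some k" using computable_program by blast
  then show ?case by (intro computableI[of "Comp Succ P"]) simp
qed

lemma computable_id: "computable (\<lambda>x. x)"
  by (rule computableI[of Ident]) simp

lemma computable_compose:
  assumes "computable g" "computable f"
  shows "computable (\<lambda>x. g (f x))"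
proof -
  obtain P Q where "\<forall>x. eval P x = Some (g x)" "\<forall>x. eval Q x = Some (f x)"
    using computable_program[OF assms(1)] computable_program[OF assms(2)] by blast
  then show ?thesis by (intro computableI[of "Comp P Q"]) simp
qed

lemma computable_Suc: "computable f \<Longrightarrow> computable (\<lambda>x. Suc (f x))"
  by (rule computable_compose[OF computableI[of Succ]]) simp_all

lemma computable_left: "computable f \<Longrightarrow> computable (\<lambda>x. left (f x))"
  by (rule computable_compose[OF computableI[of Fst]]) simp_all

lemma computable_right: "computable f \<Longrightarrow> computable (\<lambda>x. right (f x))"
  by (rule computable_compose[OF computableI[of Snd]]) simp_all

lemma computable_pair:
  assumes "computable f" "computable g"
  shows "computable (\<lambda>x. code_pair (f x) (g x))"
proof -
  obtain P Q where "\<forall>x. eval P x = Some (f x)" "\<forall>x. eval Q x = Some (g x)"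
    using computable_program[OF assms(1)] computable_program[OF assms(2)] by blast
  then show ?thesis by (intro computableI[of "Pair P Q"]) simp
qed

lemma computable_compose2:
  assumes "computable (\<lambda>z. g (left z) (right z))" "computable a" "computable b"
  shows "computable (\<lambda>x. g (a x) (b x))"
  using computable_compose[OF assms(1) computable_pair[OF assms(2,3)]] by simp

text \<open>
  The step function takes the parameter, the counter and the previous value; they are packed
  exactly as \<^const>\<open>PrimRec\<close> passes them.
\<close>

lemma computable_rec:
  assumes "computable f" "computable (\<lambda>z. g (left z) (left (right z)) (right (right z)))"
    and "computable h"
  shows "computable (\<lambda>x. rec_nat (f x) (g x) (h x))"
proof -
  obtain F G H where FGH: "\<forall>x. eval F x = Some (f x)"
      "\<forall>z. eval G z = Some (g (left z) (left (right z)) (right (right z)))"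
      "\<forall>x. eval H x = Some (h x)"
    using computable_program[OF assms(1)] computable_program[OF assms(2)]
      computable_program[OF assms(3)] by blast
  have "rec_nat (eval F x) (\<lambda>m r. Option.bind r (\<lambda>y. eval G (code_pair x (code_pair m y)))) n
      = Some (rec_nat (f x) (g x) n)" for x n
    by (induction n) (simp_all add: FGH)
  then show ?thesis
    by (intro computableI[of "Comp (PrimRec F G) (Pair Ident H)"]) (simp add: FGH)
qed

lemma computable_add: "computable f \<Longrightarrow> computable g \<Longrightarrow> computable (\<lambda>x. f x + g x)"
proof -
  assume fg: "computable f" "computable g"
  have "rec_nat a (\<lambda>_. Suc) b = a + b" for a b :: nat by (induction b) auto
  then show ?thesis
    using computable_rec[OF fg(1) _ fg(2), of "\<lambda>_ _ y. Suc y"]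
    by (simp add: computable_Suc computable_right computable_id)
qed

lemma computable_mult: "computable f \<Longrightarrow> computable g \<Longrightarrow> computable (\<lambda>x. f x * g x)"
proof -
  assume fg: "computable f" "computable g"
  have "rec_nat 0 (\<lambda>_ y. y + a) b = a * b" for a b :: nat by (induction b) auto
  then show ?thesis
    using computable_rec[OF computable_const[of 0] _ fg(2), of "\<lambda>x _ y. y + f x"]
    by (simp add: computable_add computable_compose[OF fg(1)] computable_left computable_right
        computable_id)
qed

lemma computable_diff: "computable f \<Longrightarrow> computable g \<Longrightarrow> computable (\<lambda>x. f x - g x)"
proof -
  assume fg: "computable f" "computable g"
  have "rec_nat 0 (\<lambda>m _. m) a = a - 1" for a :: nat by (cases a) auto
  then have pred: "computable (\<lambda>a. a - 1)"
    using computable_rec[OF computable_const[of 0] _ computable_id, of "\<lambda>_ m _. m"]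
    by (simp add: computable_left computable_right computable_id)
  have "rec_nat a (\<lambda>_ y. y - 1) b = a - b" for a b :: nat by (induction b) auto
  then show ?thesis
    using computable_rec[OF fg(1) computable_compose[OF pred computable_right[OF
        computable_right[OF computable_id]]] fg(2)]
    by simp
qed

text \<open>
  The symmetric difference \<open>(a - b) + (b - a)\<close> vanishes exactly when \<open>a = b\<close>, so a
  recursion along it that ignores its previous value is a case distinction.
\<close>

lemma computable_if_eq:
  assumes "computable a" "computable b" "computable f" "computable g"
  shows "computable (\<lambda>x. if a x = b x then f x else g x)"
proof -
  have "rec_nat u (\<lambda>_ _. v) ((p - q) + (q - p)) = (if p = q then u else v)" for u v p q :: nat
    by (cases "(p - q) + (q - p)") auto
  then show ?thesis
    using computable_rec[of f "\<lambda>x _ _. g x" "\<lambda>x. (a x - b x) + (b x - a x)"] assms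
    by (simp add: computable_add computable_diff computable_compose[OF assms(4)]
        computable_left computable_id)
qed

lemmas computable_arith =
  computable_const computable_id computable_Suc computable_left computable_right computable_pair
  computable_add computable_mult computable_diff computable_if_eq

lemma computable_mod:
  assumes "computable f"
  shows "computable (\<lambda>x. f x mod k)"
proof -
  have "rec_nat 0 (\<lambda>_ r. if Suc r = k then 0 else Suc r) n = n mod k" for n
    by (induction n) (simp_all add: mod_Suc)
  moreover have "computable (\<lambda>x. rec_nat 0 (\<lambda>_ r. if Suc r = k then 0 else Suc r) (f x))"
    by (intro computable_rec computable_arith assms)
  ultimately show ?thesis by simp
qed

lemma computable_div:
  assumes "computable f"
  shows "computable (\<lambda>x. f x div k)"
proof -
  have "rec_nat 0 (\<lambda>m r. if Suc (m mod k) = k then Suc r else r) n = n div k" for n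
    by (induction n) (simp_all add: div_Suc mod_Suc)
  moreover have "computable (\<lambda>x. rec_nat 0 (\<lambda>m r. if Suc (m mod k) = k then Suc r else r) (f x))"
    by (intro computable_rec computable_arith computable_mod assms)
  ultimately show ?thesis by simp
qed

lemma computable_funpow:
  assumes "computable F" "computable f" "computable g"
  shows "computable (\<lambda>x. (F ^^ f x) (g x))"
proof -
  have "rec_nat a (\<lambda>_. F) n = (F ^^ n) a" for a n by (induction n) auto
  moreover have "computable (\<lambda>x. rec_nat (g x) (\<lambda>_. F) (f x))"
    by (intro computable_rec computable_arith computable_compose[OF assms(1)] assms)
  ultimately show ?thesis by simp
qed

lemmas computable_intros = computable_arith computable_mod computable_div computable_funpow

lemma partial_computable_Some: "computable f \<Longrightarrow> partial_computable (\<lambda>x. Some (f x))"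
  by (simp add: computable_def)

lemma partial_computable_compose:
  assumes "partial_computable F" "computable f"
  shows "partial_computable (\<lambda>x. F (f x))"
proof -
  obtain P Q where "F = eval P" "\<forall>x. eval Q x = Some (f x)"
    using assms(1) computable_program[OF assms(2)] unfolding partial_computable_def by blast
  then have "(\<lambda>x. F (f x)) = eval (Comp P Q)" by auto
  then show ?thesis unfolding partial_computable_def by blast
qed

lemma partial_computable_bind:
  assumes "partial_computable F" "partial_computable (\<lambda>z. G (left z) (right z))"
  shows "partial_computable (\<lambda>x. Option.bind (F x) (G x))"
proof -
  obtain P Q where "F = eval P" and Q: "(\<lambda>z. G (left z) (right z)) = eval Q"
    using assms unfolding partial_computable_def by blast
  moreover have "eval Q (code_pair x y) = G x y" for x y by (simp flip: Q)
  ultimately have "(\<lambda>x. Option.bind (F x) (G x)) = eval (Comp Q (Pair Ident P))"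
    by (auto simp: fun_eq_iff split: bind_split)
  then show ?thesis unfolding partial_computable_def by blast
qed

lemma partial_computable_Least:
  assumes "computable (\<lambda>z. f (left z) (right z))"
  shows "partial_computable (\<lambda>x. if \<exists>n. f x n = 0 then Some (LEAST n. f x n = (0::nat)) else None)"
proof -
  obtain P where "\<forall>z. eval P z = Some (f (left z) (right z))"
    using computable_program[OF assms] by blast
  then have "(\<lambda>x. if \<exists>n. f x n = 0 then Some (LEAST n. f x n = 0) else None) = eval (Mu P)"
    by (auto simp: fun_eq_iff)
  then show ?thesis unfolding partial_computable_def by blast
qed

section \<open>A universal function\<close>

text \<open>
  Programs are executed by an abstract machine with an explicit stack of continuations, so that a
  single step is a total computable function of the coded configuration. A configuration holds a
  control word, a value and a stack: control \<open>Suc e\<close> means that program \<open>e\<close> is about to run on the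
  value, control \<open>0\<close> that the value is handed to the topmost continuation. The stack \<open>0\<close> is
  empty.

  The continuations are, by tag: 0, the first component of a pair has been computed and the second
  program is to run on the stored argument; 1, the second component has been computed; 2, the inner
  function of a composition has been computed; 3, a stage of a primitive recursion has been
  computed, stored with the current and the final counter; 4, the body of an unbounded search has
  been computed, stored with the current candidate.
\<close>

definition run :: "nat \<Rightarrow> nat \<Rightarrow> nat \<Rightarrow> nat" where
  "run e x K = code_pair (Suc e) (code_pair x K)"

definition ret :: "nat \<Rightarrow> nat \<Rightarrow> nat" where
  "ret y K = code_pair 0 (code_pair y K)"

definition push :: "nat \<Rightarrow> nat \<Rightarrow> nat \<Rightarrow> nat" where
  "push tag a K = Suc (code_pair (code_pair tag a) K)"

definition run_step :: "nat \<Rightarrow> nat \<Rightarrow> nat \<Rightarrow> nat" where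
  "run_step e x K =
    (if e = 0 then ret 0 K else if e = 1 then ret (Suc x) K
     else if e = 2 then ret (left x) K else if e = 3 then ret (right x) K
     else let d = (e - 4) div 4; i = left d; j = right d in
       if e mod 4 = 0 then run i x (push 0 (code_pair j x) K)
       else if e mod 4 = 1 then run j x (push 2 i K)
       else if e mod 4 = 2 then
         run i (left x) (push 3 (code_pair (code_pair j (left x)) (code_pair 0 (right x))) K)
       else run d (code_pair x 0) (push 4 (code_pair (code_pair d x) 0) K))"

definition ret_step :: "nat \<Rightarrow> nat \<Rightarrow> nat \<Rightarrow> nat \<Rightarrow> nat" where
  "ret_step y tag a K =
    (if tag = 0 then run (left a) (right a) (push 1 y K)
     else if tag = 1 then ret (code_pair a y) K
     else if tag = 2 then run a y K
     else let j = left (left a); x = right (left a); m = left (right a); n = right (right a) in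
       if tag = 3 then
         (if m = n then ret y K
          else run j (code_pair x (code_pair m y))
                 (push 3 (code_pair (code_pair j x) (code_pair (Suc m) n)) K))
       else
         (if y = 0 then ret (right a) K
          else run j (code_pair x (Suc (right a)))
                 (push 4 (code_pair (code_pair j x) (Suc (right a))) K)))"

definition step :: "nat \<Rightarrow> nat" where
  "step c = (let t = left c; v = left (right c); K = right (right c) in
     if t = 0 then
       if K = 0 then c else ret_step v (left (left (K - 1))) (right (left (K - 1))) (right (K - 1))
     else run_step (t - 1) v K)"

text \<open>
  Zero while the machine is working, the successor of the result once it has handed a value to the
  empty stack.
\<close>

definition outcome :: "nat \<Rightarrow> nat" where
  "outcome c = (if left c = 0 then if right (right c) = 0 then Suc (left (right c)) else 0 else 0)"

definition timed_eval :: "nat \<Rightarrow> nat \<Rightarrow> nat \<Rightarrow> nat" where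
  "timed_eval e x s = outcome ((step ^^ s) (run e x 0))"

lemma computable_step: "computable step"
  unfolding step_def run_step_def ret_step_def run_def ret_def push_def Let_def
  by (intro computable_intros)

lemma computable_outcome: "computable outcome"
  unfolding outcome_def by (intro computable_intros)

lemma computable_timed_eval:
  "computable e \<Longrightarrow> computable x \<Longrightarrow> computable s \<Longrightarrow> computable (\<lambda>z. timed_eval (e z) (x z) (s z))"
  unfolding timed_eval_def run_def
  by (intro computable_compose[OF computable_outcome] computable_intros computable_step)

lemma step_run: "step (run e x K) = run_step e x K"
  by (simp add: step_def run_def)

lemma step_ret: "step (ret y (push tag a K)) = ret_step y tag a K"
  by (simp add: step_def ret_def push_def)

lemma step_final: "outcome c \<noteq> 0 \<Longrightarrow> step c = c"
  by (simp add: step_def outcome_def split: if_splits)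

lemma outcome_run: "outcome (run e x K) = 0"
  by (simp add: outcome_def run_def)

lemma outcome_ret: "outcome (ret y K) = (if K = 0 then Suc y else 0)"
  by (simp add: outcome_def ret_def)

lemma prog_of_eq_iff:
  "prog_of e = Zero \<longleftrightarrow> e = 0" "prog_of e = Succ \<longleftrightarrow> e = 1"
  "prog_of e = Fst \<longleftrightarrow> e = 2" "prog_of e = Snd \<longleftrightarrow> e = 3"
  by (subst prog_of.simps; simp add: Let_def)+

lemma prog_of_Pair: "prog_of e = Pair P Q \<Longrightarrow> e \<ge> 4 \<and> e mod 4 = 0 \<and>
    prog_of (left ((e - 4) div 4)) = P \<and> prog_of (right ((e - 4) div 4)) = Q"
  by (subst (asm) prog_of.simps) (simp add: Let_def split: if_splits)

lemma prog_of_Comp: "prog_of e = Comp P Q \<Longrightarrow> e \<ge> 4 \<and> e mod 4 = 1 \<and>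
    prog_of (left ((e - 4) div 4)) = P \<and> prog_of (right ((e - 4) div 4)) = Q"
  by (subst (asm) prog_of.simps) (simp add: Let_def split: if_splits)

lemma prog_of_PrimRec: "prog_of e = PrimRec P Q \<Longrightarrow> e \<ge> 4 \<and> e mod 4 = 2 \<and>
    prog_of (left ((e - 4) div 4)) = P \<and> prog_of (right ((e - 4) div 4)) = Q"
  by (subst (asm) prog_of.simps) (simp add: Let_def split: if_splits)

lemma prog_of_Mu: "prog_of e = Mu P \<Longrightarrow> e \<ge> 4 \<and> e mod 4 = 3 \<and> prog_of ((e - 4) div 4) = P"
  by (subst (asm) prog_of.simps) (simp add: Let_def split: if_splits)

text \<open>
  Execution is compared with \<^const>\<open>eval\<close> in two directions: a defined value is always reached,
  whatever the stack (\<open>simulates\<close>), and an execution that ends has a defined value. Since final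
  configurations are fixed points of \<^const>\<open>step\<close>, the second direction may freely pass to
  intermediate configurations (\<open>halts_reaches\<close>).
\<close>

definition reaches :: "nat \<Rightarrow> nat \<Rightarrow> bool" where
  "reaches c c' \<longleftrightarrow> (\<exists>t. (step ^^ t) c = c')"

definition halts :: "nat \<Rightarrow> bool" where
  "halts c \<longleftrightarrow> (\<exists>t. outcome ((step ^^ t) c) \<noteq> 0)"

definition simulates :: "nat \<Rightarrow> prog \<Rightarrow> bool" where
  "simulates e P \<longleftrightarrow> (\<forall>x y K. eval P x = Some y \<longrightarrow> reaches (run e x K) (ret y K))"

lemma reaches_trans [trans]: "reaches c c' \<Longrightarrow> reaches c' c'' \<Longrightarrow> reaches c c''"
  unfolding reaches_def by (metis comp_apply funpow_add)

lemma reaches_step: "reaches c (step c)"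
  unfolding reaches_def by (rule exI[of _ 1]) simp

lemma funpow_final: "outcome c \<noteq> 0 \<Longrightarrow> (step ^^ t) c = c"
  by (induction t) (simp_all add: step_final)

lemma funpow_step_eq:
  assumes "outcome ((step ^^ s) c) \<noteq> 0" "s \<le> t"
  shows "(step ^^ t) c = (step ^^ s) c"
proof -
  have "(step ^^ t) c = (step ^^ (t - s)) ((step ^^ s) c)"
    using assms(2) by (metis comp_apply funpow_add le_add_diff_inverse2)
  then show ?thesis using funpow_final[OF assms(1)] by simp
qed

lemma halts_reaches:
  assumes "halts c" "reaches c c'"
  shows "halts c'"
proof -
  obtain s t where s: "outcome ((step ^^ s) c) \<noteq> 0" and t: "(step ^^ t) c = c'"
    using assms unfolding halts_def reaches_def by blast
  have "(step ^^ s) c' = (step ^^ (s + t)) c" using t by (simp add: funpow_add)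
  then have "(step ^^ s) c' = (step ^^ s) c" using funpow_step_eq[OF s, of "s + t"] by simp
  then show ?thesis using s unfolding halts_def by metis
qed

lemma reaches_run: "reaches (run e x K) (run_step e x K)"
  using reaches_step[of "run e x K"] by (simp add: step_run)

lemma reaches_ret: "reaches (ret y (push tag a K)) (ret_step y tag a K)"
  using reaches_step[of "ret y (push tag a K)"] by (simp add: step_ret)

lemma reaches_Pair1:
  assumes "prog_of e = Pair P Q"
  shows "reaches (run e x K)
    (run (left ((e - 4) div 4)) x (push 0 (code_pair (right ((e - 4) div 4)) x) K))"
  using reaches_run[of e x K] prog_of_Pair[OF assms] by (auto simp: run_step_def Let_def)

lemma reaches_Pair2: "reaches (ret a (push 0 (code_pair j x) K)) (run j x (push 1 a K))"
  using reaches_ret[of a 0 "code_pair j x" K] by (simp add: ret_step_def)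

lemma reaches_Pair3: "reaches (ret b (push 1 a K)) (ret (code_pair a b) K)"
  using reaches_ret[of b 1 a K] by (simp add: ret_step_def)

lemma reaches_Comp1:
  assumes "prog_of e = Comp P Q"
  shows "reaches (run e x K)
    (run (right ((e - 4) div 4)) x (push 2 (left ((e - 4) div 4)) K))"
  using reaches_run[of e x K] prog_of_Comp[OF assms] by (auto simp: run_step_def Let_def)

lemma reaches_Comp2: "reaches (ret y (push 2 i K)) (run i y K)"
  using reaches_ret[of y 2 i K] by (simp add: ret_step_def)

lemma reaches_PrimRec1:
  assumes "prog_of e = PrimRec P Q"
  shows "reaches (run e x K) (run (left ((e - 4) div 4)) (left x)
    (push 3 (code_pair (code_pair (right ((e - 4) div 4)) (left x)) (code_pair 0 (right x))) K))"
  using reaches_run[of e x K] prog_of_PrimRec[OF assms] by (auto simp: run_step_def Let_def)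

lemma reaches_PrimRec2: "m \<noteq> n \<Longrightarrow>
  reaches (ret y (push 3 (code_pair (code_pair j a) (code_pair m n)) K))
    (run j (code_pair a (code_pair m y)) (push 3 (code_pair (code_pair j a) (code_pair (Suc m) n)) K))"
  using reaches_ret[of y 3 "code_pair (code_pair j a) (code_pair m n)" K]
  by (simp add: ret_step_def)

lemma reaches_PrimRec3:
  "reaches (ret y (push 3 (code_pair (code_pair j a) (code_pair n n)) K)) (ret y K)"
  using reaches_ret[of y 3 "code_pair (code_pair j a) (code_pair n n)" K]
  by (simp add: ret_step_def)

lemma reaches_Mu1:
  assumes "prog_of e = Mu P"
  shows "reaches (run e x K) (run ((e - 4) div 4) (code_pair x 0)
    (push 4 (code_pair (code_pair ((e - 4) div 4) x) 0) K))"
  using reaches_run[of e x K] prog_of_Mu[OF assms] by (auto simp: run_step_def Let_def)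

lemma step_Mu2: "step (ret (Suc y) (push 4 (code_pair (code_pair d x) n) K)) =
    run d (code_pair x (Suc n)) (push 4 (code_pair (code_pair d x) (Suc n)) K)"
  by (simp add: step_ret ret_step_def)

lemma reaches_Mu3: "reaches (ret 0 (push 4 (code_pair (code_pair d x) n) K)) (ret n K)"
  using reaches_ret[of 0 4 "code_pair (code_pair d x) n" K]
  by (simp add: ret_step_def)

lemma PrimRec_loop:
  assumes "simulates i P" "simulates j Q"
  shows "rec_nat (eval P a) (\<lambda>m r. Option.bind r (\<lambda>y. eval Q (code_pair a (code_pair m y)))) m
      = Some z \<Longrightarrow> m \<le> n \<Longrightarrow>
    reaches (run i a (push 3 (code_pair (code_pair j a) (code_pair 0 n)) K))
      (ret z (push 3 (code_pair (code_pair j a) (code_pair m n)) K))"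
proof (induction m arbitrary: z)
  case 0
  then show ?case using assms(1) unfolding simulates_def by simp
next
  case (Suc m)
  then obtain y where y: "rec_nat (eval P a)
      (\<lambda>m r. Option.bind r (\<lambda>y. eval Q (code_pair a (code_pair m y)))) m = Some y"
    and z: "eval Q (code_pair a (code_pair m y)) = Some z"
    by (auto simp: bind_eq_Some_conv)
  note Suc.IH[OF y]
  also note reaches_PrimRec2
  also have "reaches
      (run j (code_pair a (code_pair m y)) (push 3 (code_pair (code_pair j a) (code_pair (Suc m) n)) K))
      (ret z (push 3 (code_pair (code_pair j a) (code_pair (Suc m) n)) K))"
    using assms(2) z unfolding simulates_def by blast
  finally show ?case using Suc.prems by simp
qed

text \<open>
  The bound \<open>t \<ge> m\<close> on the number of steps serves to refute halting: a machine that ends within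
  \<open>u\<close> steps cannot have passed through \<open>u\<close> candidates.
\<close>

lemma Mu_loop:
  assumes "simulates d P"
  shows "\<forall>k<m. \<exists>y. eval P (code_pair x k) = Some (Suc y) \<Longrightarrow>
    \<exists>t\<ge>m. (step ^^ t) (run d (code_pair x 0) (push 4 (code_pair (code_pair d x) 0) K))
      = run d (code_pair x m) (push 4 (code_pair (code_pair d x) m) K)"
proof (induction m)
  case 0
  then show ?case by (intro exI[of _ 0]) simp
next
  case (Suc m)
  let ?c = "\<lambda>m. push 4 (code_pair (code_pair d x) m) K"
  obtain t where t: "t \<ge> m"
    "(step ^^ t) (run d (code_pair x 0) (?c 0)) = run d (code_pair x m) (?c m)"
    using Suc by auto
  obtain y where "eval P (code_pair x m) = Some (Suc y)" using Suc.prems by blast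
  then obtain u where "(step ^^ u) (run d (code_pair x m) (?c m)) = ret (Suc y) (?c m)"
    using assms unfolding simulates_def reaches_def by blast
  then have "(step ^^ (Suc (u + t))) (run d (code_pair x 0) (?c 0)) =
      run d (code_pair x (Suc m)) (?c (Suc m))"
    using t(2) by (simp add: funpow_add step_Mu2)
  then show ?case using t(1) by (intro exI[of _ "Suc (u + t)"]) simp
qed

lemma simulates_prog_of: "prog_of e = P \<Longrightarrow> simulates e P"
proof (induction P arbitrary: e)
  case Zero
  then show ?case using reaches_run[of e]
    by (simp add: simulates_def prog_of_eq_iff run_step_def)
next
  case Succ
  then show ?case using reaches_run[of e]
    by (simp add: simulates_def prog_of_eq_iff run_step_def)
next
  case Fst
  then show ?case using reaches_run[of e]
    by (simp add: simulates_def prog_of_eq_iff run_step_def)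
next
  case Snd
  then show ?case using reaches_run[of e]
    by (simp add: simulates_def prog_of_eq_iff run_step_def)
next
  case (Pair P Q)
  let ?i = "left ((e - 4) div 4)" and ?j = "right ((e - 4) div 4)"
  have IH: "simulates ?i P" "simulates ?j Q" using Pair prog_of_Pair by blast+
  show ?case unfolding simulates_def
  proof (intro allI impI)
    fix x y K
    assume "eval (prog.Pair P Q) x = Some y"
    then obtain a b where ab: "eval P x = Some a" "eval Q x = Some b" "y = code_pair a b"
      by (auto simp: bind_eq_Some_conv)
    note reaches_Pair1[OF Pair.prems]
    also have "reaches (run ?i x (push 0 (code_pair ?j x) K)) (ret a (push 0 (code_pair ?j x) K))"
      using IH(1) ab(1) unfolding simulates_def by blast
    also note reaches_Pair2
    also have "reaches (run ?j x (push 1 a K)) (ret b (push 1 a K))"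
      using IH(2) ab(2) unfolding simulates_def by blast
    also note reaches_Pair3
    finally show "reaches (run e x K) (ret y K)" using ab(3) by simp
  qed
next
  case (Comp P Q)
  let ?i = "left ((e - 4) div 4)" and ?j = "right ((e - 4) div 4)"
  have IH: "simulates ?i P" "simulates ?j Q" using Comp prog_of_Comp by blast+
  show ?case unfolding simulates_def
  proof (intro allI impI)
    fix x y K
    assume "eval (prog.Comp P Q) x = Some y"
    then obtain a where a: "eval Q x = Some a" "eval P a = Some y"
      by (auto simp: bind_eq_Some_conv)
    note reaches_Comp1[OF Comp.prems]
    also have "reaches (run ?j x (push 2 ?i K)) (ret a (push 2 ?i K))"
      using IH(2) a(1) unfolding simulates_def by blast
    also note reaches_Comp2
    also have "reaches (run ?i a K) (ret y K)"
      using IH(1) a(2) unfolding simulates_def by blast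
    finally show "reaches (run e x K) (ret y K)" .
  qed
next
  case (PrimRec P Q)
  let ?i = "left ((e - 4) div 4)" and ?j = "right ((e - 4) div 4)"
  have IH: "simulates ?i P" "simulates ?j Q" using PrimRec prog_of_PrimRec by blast+
  show ?case unfolding simulates_def
  proof (intro allI impI)
    fix x y K
    assume y: "eval (prog.PrimRec P Q) x = Some y"
    note reaches_PrimRec1[OF PrimRec.prems]
    also have "reaches (run ?i (left x)
        (push 3 (code_pair (code_pair ?j (left x)) (code_pair 0 (right x))) K))
      (ret y (push 3 (code_pair (code_pair ?j (left x)) (code_pair (right x) (right x))) K))"
      by (rule PrimRec_loop[OF IH]) (use y in \<open>simp_all add: case_prod_beta\<close>)
    also note reaches_PrimRec3
    finally show "reaches (run e x K) (ret y K)" .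
  qed
next
  case (Mu P)
  let ?d = "(e - 4) div 4"
  have IH: "simulates ?d P" using Mu prog_of_Mu by blast
  show ?case unfolding simulates_def
  proof (intro allI impI)
    fix x y K
    assume "eval (prog.Mu P) x = Some y"
    then obtain n where n: "eval P (code_pair x n) = Some 0"
        "\<forall>m<n. eval P (code_pair x m) \<noteq> None"
      and y: "y = (LEAST n. eval P (code_pair x n) = Some 0)"
      by (auto split: if_splits)
    have zero: "eval P (code_pair x y) = Some 0" unfolding y using n(1) by (rule LeastI)
    have "\<exists>z. eval P (code_pair x k) = Some (Suc z)" if "k < y" for k
    proof -
      have "eval P (code_pair x k) \<noteq> Some 0" using that unfolding y by (rule not_less_Least)
      moreover have "k < n" using that Least_le[of "\<lambda>n. eval P (code_pair x n) = Some 0", OF n(1)]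
        unfolding y by simp
      ultimately show ?thesis using n(2) by (metis option.exhaust old.nat.exhaust)
    qed
    then obtain t where "(step ^^ t) (run ?d (code_pair x 0) (push 4 (code_pair (code_pair ?d x) 0) K))
        = run ?d (code_pair x y) (push 4 (code_pair (code_pair ?d x) y) K)"
      using Mu_loop[OF IH, of y x K] by blast
    note reaches_Mu1[OF Mu.prems]
    also have "reaches (run ?d (code_pair x 0) (push 4 (code_pair (code_pair ?d x) 0) K))
        (run ?d (code_pair x y) (push 4 (code_pair (code_pair ?d x) y) K))"
      unfolding reaches_def by (rule exI) fact
    also have "reaches (run ?d (code_pair x y) (push 4 (code_pair (code_pair ?d x) y) K))
        (ret 0 (push 4 (code_pair (code_pair ?d x) y) K))"
      using IH zero unfolding simulates_def by blast
    also note reaches_Mu3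
    finally show "reaches (run e x K) (ret y K)" .
  qed
qed

text \<open>
  Induction on the program: as the whole execution halts, so does that of the first subprogram;
  its value is then defined and, by simulation, handed to the continuation, which starts the next
  subprogram. For an unbounded search, undefinedness would mean that every candidate in turn has a
  defined positive value, so that the machine works forever.
\<close>

lemma halts_imp_defined: "prog_of e = P \<Longrightarrow> halts (run e x K) \<Longrightarrow> \<exists>y. eval P x = Some y"
proof (induction P arbitrary: e x K)
  case (Pair P Q)
  let ?i = "left ((e - 4) div 4)" and ?j = "right ((e - 4) div 4)"
  have ij: "prog_of ?i = P" "prog_of ?j = Q" using prog_of_Pair[OF Pair.prems(1)] by auto
  note h = halts_reaches[OF Pair.prems(2) reaches_Pair1[OF Pair.prems(1)]]
  then obtain a where a: "eval P x = Some a" using Pair.IH(1)[OF ij(1)] by blast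
  have "halts (ret a (push 0 (code_pair ?j x) K))"
    using h a simulates_prog_of[OF ij(1)] halts_reaches unfolding simulates_def by blast
  then have "halts (run ?j x (push 1 a K))" using reaches_Pair2 by (rule halts_reaches)
  then obtain b where "eval Q x = Some b" using Pair.IH(2)[OF ij(2)] by blast
  then show ?case using a by simp
next
  case (Comp P Q)
  let ?i = "left ((e - 4) div 4)" and ?j = "right ((e - 4) div 4)"
  have ij: "prog_of ?i = P" "prog_of ?j = Q" using prog_of_Comp[OF Comp.prems(1)] by auto
  note h = halts_reaches[OF Comp.prems(2) reaches_Comp1[OF Comp.prems(1)]]
  then obtain a where a: "eval Q x = Some a" using Comp.IH(2)[OF ij(2)] by blast
  have "halts (ret a (push 2 ?i K))"
    using h a simulates_prog_of[OF ij(2)] halts_reaches unfolding simulates_def by blast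
  then have "halts (run ?i a K)" using reaches_Comp2 by (rule halts_reaches)
  then obtain b where "eval P a = Some b" using Comp.IH(1)[OF ij(1)] by blast
  then show ?case using a by simp
next
  case (PrimRec P Q)
  let ?i = "left ((e - 4) div 4)" and ?j = "right ((e - 4) div 4)"
  let ?a = "left x" and ?n = "right x"
  let ?r = "rec_nat (eval P ?a)
      (\<lambda>m r. Option.bind r (\<lambda>y. eval Q (code_pair ?a (code_pair m y))))"
  have ij: "prog_of ?i = P" "prog_of ?j = Q" using prog_of_PrimRec[OF PrimRec.prems(1)] by auto
  note sim = simulates_prog_of[OF ij(1)] simulates_prog_of[OF ij(2)]
  note h = halts_reaches[OF PrimRec.prems(2) reaches_PrimRec1[OF PrimRec.prems(1)]]
  have "\<exists>z. ?r m = Some z" if "m \<le> ?n" for m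
    using that
  proof (induction m)
    case 0
    then show ?case using PrimRec.IH(1)[OF ij(1) h] by simp
  next
    case (Suc m)
    then obtain z where z: "?r m = Some z" by auto
    have "halts (ret z (push 3 (code_pair (code_pair ?j ?a) (code_pair m ?n)) K))"
      using halts_reaches[OF h PrimRec_loop[OF sim z]] Suc.prems by simp
    then have "halts (run ?j (code_pair ?a (code_pair m z))
        (push 3 (code_pair (code_pair ?j ?a) (code_pair (Suc m) ?n)) K))"
      using reaches_PrimRec2 Suc.prems by (metis Suc_n_not_le_n halts_reaches)
    then show ?case using PrimRec.IH(2)[OF ij(2)] z by simp
  qed
  then show ?case by (simp add: case_prod_beta)
next
  case (Mu P)
  let ?d = "(e - 4) div 4"
  let ?c = "\<lambda>m. run ?d (code_pair x m) (push 4 (code_pair (code_pair ?d x) m) K)"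
  have d: "prog_of ?d = P" using prog_of_Mu[OF Mu.prems(1)] by auto
  note loop = Mu_loop[OF simulates_prog_of[OF d], where x=x and K=K]
  have h: "halts (?c 0)" by (rule halts_reaches[OF Mu.prems(2) reaches_Mu1[OF Mu.prems(1)]])
  show ?case
  proof (rule ccontr)
    assume undef: "\<not> ?case"
    have pos: "\<forall>k<m. \<exists>y. eval P (code_pair x k) = Some (Suc y)" for m
    proof (induction m)
      case (Suc m)
      then obtain t where "(step ^^ t) (?c 0) = ?c m" using loop by blast
      then have "halts (?c m)" using h halts_reaches unfolding reaches_def by blast
      then obtain y where y: "eval P (code_pair x m) = Some y" using Mu.IH[OF d] by blast
      moreover have "y \<noteq> 0"
      proof
        assume "y = 0"
        then have "eval (prog.Mu P) x \<noteq> None" using y Suc by fastforce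
        then show False using undef by blast
      qed
      ultimately have "\<exists>z. eval P (code_pair x m) = Some (Suc z)" by (cases y) auto
      then show ?case using Suc less_Suc_eq by metis
    qed simp
    obtain u where u: "outcome ((step ^^ u) (?c 0)) \<noteq> 0" using h unfolding halts_def by blast
    obtain t where "t \<ge> u" "(step ^^ t) (?c 0) = ?c u" using loop[OF pos] by blast
    then have "outcome (?c u) \<noteq> 0" using funpow_step_eq[OF u] u by metis
    then show False by (simp add: outcome_run)
  qed
qed simp_all

text \<open>
  The normal form: \<^const>\<open>timed_eval\<close> is a total computable approximation to all partial computable
  functions at once.
\<close>

lemma phi_eq_Some_iff: "phi e x = Some y \<longleftrightarrow> (\<exists>s. timed_eval e x s = Suc y)"
proof
  assume "phi e x = Some y"
  then have "reaches (run e x 0) (ret y 0)"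
    using simulates_prog_of unfolding simulates_def phi_def by blast
  then obtain s where "(step ^^ s) (run e x 0) = ret y 0" unfolding reaches_def by blast
  then show "\<exists>s. timed_eval e x s = Suc y"
    unfolding timed_eval_def by (intro exI[of _ s]) (simp add: outcome_ret)
next
  assume "\<exists>s. timed_eval e x s = Suc y"
  then obtain s where s: "outcome ((step ^^ s) (run e x 0)) = Suc y"
    unfolding timed_eval_def by blast
  then have "halts (run e x 0)" unfolding halts_def by (metis nat.distinct(1))
  then obtain z where z: "phi e x = Some z" using halts_imp_defined unfolding phi_def by blast
  then have "reaches (run e x 0) (ret z 0)"
    using simulates_prog_of unfolding simulates_def phi_def by blast
  then obtain t where t: "(step ^^ t) (run e x 0) = ret z 0" unfolding reaches_def by blast
  then have "outcome ((step ^^ t) (run e x 0)) = Suc z" by (simp add: outcome_ret)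
  then have "Suc y = Suc z"
    using s funpow_step_eq[of s "run e x 0" t] funpow_step_eq[of t "run e x 0" s]
    by (metis nat.distinct(1) nle_le)
  then show "phi e x = Some y" using z by simp
qed

text \<open>
  The universal function, obtained by searching for a stage at which \<^const>\<open>timed_eval\<close> is positive.
\<close>

lemma partial_computable_phi: "partial_computable (\<lambda>z. phi (left z) (right z))"
proof -
  let ?T = "\<lambda>z s. timed_eval (left z) (right z) s"
  let ?L = "\<lambda>z. if \<exists>s. 1 - ?T z s = 0 then Some (LEAST s. 1 - ?T z s = 0) else None"
  have "partial_computable (\<lambda>z. Option.bind (?L z) (\<lambda>s. Some (?T z s - 1)))"
    by (intro partial_computable_bind partial_computable_Least partial_computable_Some
        computable_timed_eval computable_intros)
  moreover have "Option.bind (?L z) (\<lambda>s. Some (?T z s - 1)) = phi (left z) (right z)" for z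
  proof (cases "phi (left z) (right z)")
    case None
    then have "?T z s = 0" for s using phi_eq_Some_iff by (metis not0_implies_Suc option.distinct(1))
    then show ?thesis using None by simp
  next
    case (Some y)
    then have ex: "\<exists>s. 1 - ?T z s = 0" using phi_eq_Some_iff
      by (metis diff_Suc_1' diff_Suc_Suc diff_0_eq_0 One_nat_def)
    let ?s = "LEAST s. 1 - ?T z s = 0"
    have "1 - ?T z ?s = 0" using ex by (rule LeastI_ex)
    then obtain v where v: "?T z ?s = Suc v" by (cases "?T z ?s") auto
    then have "phi (left z) (right z) = Some v" using phi_eq_Some_iff by blast
    then show ?thesis using ex v by simp
  qed
  ultimately show ?thesis by simp
qed

section \<open>Uniform indices\<close>

definition Comp_code :: "nat \<Rightarrow> nat \<Rightarrow> nat" where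
  "Comp_code i j = 4 * code_pair i j + 5"

definition Pair_code :: "nat \<Rightarrow> nat \<Rightarrow> nat" where
  "Pair_code i j = 4 * code_pair i j + 4"

definition const_code :: "nat \<Rightarrow> nat" where
  "const_code a = rec_nat 0 (\<lambda>_ c. Comp_code 1 c) a"

lemma prog_of_Comp_code: "prog_of (Comp_code i j) = Comp (prog_of i) (prog_of j)"
proof -
  have "(4 * d + 5) mod 4 = 1" "(4 * d + 5 - 4) div 4 = d" for d :: nat by presburger+
  then show ?thesis unfolding Comp_code_def by (subst prog_of.simps) (simp add: Let_def)
qed

lemma prog_of_Pair_code: "prog_of (Pair_code i j) = Pair (prog_of i) (prog_of j)"
  unfolding Pair_code_def by (subst prog_of.simps) (simp add: Let_def)

lemma phi_const_code: "phi (const_code a) n = Some a"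
proof (induction a)
  case 0
  have "prog_of 0 = Zero" by (simp add: prog_of_eq_iff)
  then show ?case by (simp add: const_code_def phi_def)
next
  case (Suc a)
  have "prog_of 1 = Succ" by (simp add: prog_of_eq_iff)
  moreover have "const_code (Suc a) = Comp_code 1 (const_code a)" by (simp add: const_code_def)
  ultimately show ?case using Suc by (simp add: phi_def prog_of_Comp_code)
qed

text \<open>
  The parameter theorem. The index \<open>S a\<close> is that of \<open>n \<mapsto> F \<langle>a, n\<rangle>\<close>, composed from an index of
  \<open>F\<close>, an index of the constant function \<open>a\<close> and the index of the identity.
\<close>

lemma uniform_index:
  assumes "partial_computable F"
  obtains S where "computable S" "\<And>a n. phi (S a) n = F (code_pair a n)"
proof -
  obtain e where e: "F = phi e" using assms partial_computable_iff_index by blast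
  define S where "S a = Comp_code e (Pair_code (const_code a) (Pair_code 2 3))" for a
  have "prog_of 2 = Fst" "prog_of 3 = Snd" by (simp_all add: prog_of_eq_iff)
  then have "phi (S a) n = F (code_pair a n)" for a n
    using phi_const_code[of a n]
    by (simp add: S_def e phi_def prog_of_Comp_code prog_of_Pair_code)
  moreover have "computable S"
    unfolding S_def Comp_code_def Pair_code_def const_code_def
    by (intro computable_intros computable_rec)
  ultimately show ?thesis using that by blast
qed

section \<open>A second-level subobject of Baire space that represents L\<close>

text \<open>
  A point of Baire space is read as the pair of its subsequences at even and at odd places;
  \<open>half i x\<close> is the component whose vanishing is asserted by the witness \<open>i\<close>.
\<close>

definition half :: "nat \<Rightarrow> (nat \<Rightarrow> nat) \<Rightarrow> nat \<Rightarrow> nat" where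
  "half i x k = x (2 * k + (if i = 0 then 0 else 1))"

definition coded_L :: "'c coding_system \<Rightarrow> ('c, nat \<Rightarrow> nat) rspace" where
  "coded_L C = witnessed_union C (\<lambda>i. subspace (baire C) {x. \<forall>k. half i x k = 0})"

lemma coded_L_eq_Some_iff:
  "coded_L C c = Some x \<longleftrightarrow> (\<exists>i. omega C (tup1 C c) = Some i \<and> baire C (tup2 C c) = Some x \<and>
     (\<forall>k. half i x k = 0))"
  by (auto simp: coded_L_def witnessed_union_def subspace_def split: option.splits)

text \<open>
  The witnessed union is formed directly over a sequence of subspaces of Baire space, so that its
  complexity rests on three realizers only: the identity, the second projection, and evaluation of
  a point at a given place.
\<close>

lemma sigma02_coded_L:
  fixes C :: "'c coding_system"
  assumes "realizable C Some"
    and "realizable C (\<lambda>c. Some (tup2 C c))"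
    and "realizable C F"
    and "realizes (prod_space C (omega C) (prod_space C (baire C) (omega C))) (omega C) F
           (\<lambda>(i, x, k). half i x k)"
    and "points (omega C) = UNIV"
    and "\<And>a b. tup2 C (tup C a b) = b"
  shows "sigma02 C (coded_L C)"
proof -
  let ?P = "\<lambda>i. subspace (baire C) {x. \<forall>k. half i x k = 0}"
  have refl: "sub_equiv C A A" for A :: "('c, nat \<Rightarrow> nat) rspace"
    using assms(1) unfolding sub_equiv_def subobject_def morphism_def realizes_def by auto
  have "subobject C (coded_L C) (baire C)"
    using assms(2) unfolding subobject_def morphism_def realizes_def
    by (auto simp: ran_def coded_L_eq_Some_iff intro!: exI[of _ "\<lambda>c. Some (tup2 C c)"])
  moreover have "unif_pi01 C ?P"
  proof -
    have "subobject C (?P i) (baire C)" for i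
      using assms(1) unfolding subobject_def morphism_def realizes_def
      by (auto simp: ran_def subspace_def split: option.splits if_splits intro!: exI[of _ Some])
    moreover have "unif_included C ?P ?P"
      unfolding unif_included_def using assms(2,6)
      by (intro exI[of _ "\<lambda>c. Some (tup2 C c)"]) simp
    moreover have "morphism C (prod_space C (omega C) (prod_space C (baire C) (omega C))) (omega C)
        (\<lambda>(i, x, k). half i x k)"
      unfolding morphism_def using assms(3-5) by blast
    ultimately show ?thesis
      unfolding unif_pi01_def Let_def
      by (intro conjI allI exI[of _ "\<lambda>(i, x, k). half i x k"]) simp_all
  qed
  ultimately show ?thesis
    unfolding sigma02_def using refl[of "coded_L C"] unfolding coded_L_def by blast
qed

text \<open>
  On indices, evaluation at a place is the universal function.
\<close>

lemma sigma02_coded_L_K1: "sigma02 K1 (coded_L K1)"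
proof (rule sigma02_coded_L)
  let ?F = "\<lambda>c. phi (left (right c)) (2 * right (right c) + (if left c = 0 then 0 else 1))"
  show "realizable K1 Some" "realizable K1 (\<lambda>c. Some (tup2 K1 c))"
    unfolding K1_def by (simp_all add: partial_computable_Some computable_intros)
  have "partial_computable (\<lambda>c. (\<lambda>z. phi (left z) (right z))
      (code_pair (left (right c)) (2 * right (right c) + (if left c = 0 then 0 else 1))))"
    by (intro partial_computable_compose[OF partial_computable_phi] computable_intros)
  then show "realizable K1 ?F" by (simp add: K1_def)
  show "realizes (prod_space K1 (omega K1) (prod_space K1 (baire K1) (omega K1))) (omega K1) ?F
      (\<lambda>(i, x, k). half i x k)"
    unfolding realizes_def
    by (auto simp: K1_def prod_space_def half_def split: option.splits if_splits)
  show "points (omega K1) = UNIV" by (auto simp: K1_def ran_def)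
qed (rule tupling_K1)

section \<open>Computable elements of the second Kleene algebra\<close>

text \<open>
  A query made by \<^const>\<open>k2_app\<close> is a coded list. \<open>entry i w\<close> is the successor of the \<open>i\<close>-th member of
  the list coded by \<open>w\<close>, and \<open>0\<close> beyond its end, matching the convention that an associate answers
  \<open>0\<close> to ask for more of its argument.
\<close>

definition entry :: "nat \<Rightarrow> nat \<Rightarrow> nat" where
  "entry i w = (let v = ((\<lambda>w. right (w - 1)) ^^ i) w in if v = 0 then 0 else Suc (left (v - 1)))"

lemma computable_entry: "computable i \<Longrightarrow> computable w \<Longrightarrow> computable (\<lambda>z. entry (i z) (w z))"
  unfolding entry_def Let_def by (intro computable_intros)

lemma entry_list_encode: "entry i (list_encode xs) = (if i < length xs then Suc (xs ! i) else 0)"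
proof -
  have "right 0 = 0" using prod_encode_inverse[of "(0, 0)"] by (simp add: prod_encode_def)
  then have tail: "right (list_encode xs - 1) = list_encode (drop 1 xs)" for xs
    by (cases xs) simp_all
  have drop: "((\<lambda>w. right (w - 1)) ^^ i) (list_encode xs) = list_encode (drop i xs)"
  proof (induction i)
    case (Suc i)
    then show ?case using tail[of "drop i xs"] by simp
  qed simp
  show ?thesis
  proof (cases "i < length xs")
    case True
    then have "drop i xs = xs ! i # drop (Suc i) xs" by (simp add: Cons_nth_drop_Suc)
    then show ?thesis using True unfolding entry_def drop by (simp add: Let_def)
  next
    case False
    then show ?thesis unfolding entry_def drop by simp
  qed
qed

lemma entry_query:
  "entry 0 (k2_query x n k) = Suc n"
  "entry (Suc i) (k2_query x n k) = (if i < k then Suc (x i) else 0)"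
  unfolding k2_query_def entry_list_encode by simp_all

text \<open>
  An associate whose positive answers are all correct may answer late; which answer comes first does
  not matter.
\<close>

lemma k2_appI:
  assumes "\<And>n k. p (k2_query x n k) = 0 \<or> p (k2_query x n k) = Suc (y n)"
    and "\<And>n. \<exists>k. p (k2_query x n k) \<noteq> 0"
  shows "k2_app p x = Some y"
proof -
  have "p (k2_query x n (LEAST k. p (k2_query x n k) > 0)) = Suc (y n)" for n
    using assms(1)[of n] LeastI_ex[of "\<lambda>k. p (k2_query x n k) > 0"] assms(2)[of n]
    by (metis gr0I less_not_refl)
  then show ?thesis using assms(2) by (auto simp: k2_app_def)
qed

lemma realizable_KV_I:
  assumes "computable p" "\<And>x. k2_app p x = Some (f x)"
  shows "realizable KV (\<lambda>x. Some (f x))"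
  using assms by (auto simp: KV_def K2_def intro!: exI[of _ p])

lemma realizable_KV_reindex:
  assumes "computable g"
  shows "realizable KV (\<lambda>x. Some (\<lambda>n. x (g n)))"
proof (rule realizable_KV_I)
  let ?p = "\<lambda>w. entry (Suc (g (entry 0 w - 1))) w"
  show "computable ?p"
    by (intro computable_entry computable_intros computable_compose[OF assms])
  show "k2_app ?p x = Some (\<lambda>n. x (g n))" for x
    by (rule k2_appI) (auto simp: entry_query)
qed

text \<open>
  A name \<open>c\<close> of \<open>(i, x, k)\<close> in the product space satisfies \<open>i = c 0\<close>, \<open>k = c 3\<close> and
  \<open>x n = c (4 * n + 1)\<close>. Hence \<open>half i x k\<close> is the value of \<open>c\<close> at \<open>4 * (2 * k) + 1\<close> or four places
  further, and the associate first waits for \<open>c 3\<close> in order to learn which place to read.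
\<close>

lemma realizable_KV_half:
  "realizable KV (\<lambda>c. Some (\<lambda>n. if n = 0 then c (8 * c 3 + 1 + (if c 0 = 0 then 0 else 4)) else 0))"
proof (rule realizable_KV_I)
  let ?p = "\<lambda>w. if entry 0 w = 1 then if entry 4 w = 0 then 0
      else entry (Suc (8 * (entry 4 w - 1) + 1 + (if entry 1 w = 1 then 0 else 4))) w else 1"
  show "computable ?p"
    by (intro computable_entry computable_intros)
  have four: "entry 4 (k2_query x n k) = (if 3 < k then Suc (x 3) else 0)"
    "entry 1 (k2_query x n k) = (if 0 < k then Suc (x 0) else 0)" for x n k
    using entry_query(2)[of 3] entry_query(2)[of 0] by (simp_all add: numeral_eq_Suc)
  fix c :: "nat \<Rightarrow> nat"
  show "k2_app ?p c = Some (\<lambda>n. if n = 0 then c (8 * c 3 + 1 + (if c 0 = 0 then 0 else 4)) else 0)"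
  proof (rule k2_appI)
    fix n
    show "\<exists>k. ?p (k2_query c n k) \<noteq> 0"
      by (intro exI[of _ "8 * c 3 + 10"]) (auto simp: entry_query four)
  qed (auto simp: entry_query four)
qed

lemma realizable_K2_of_KV: "realizable KV F \<Longrightarrow> realizable K2 F"
  by (auto simp: KV_def K2_def)

lemma KV_simps:
  "tup KV = tup K2" "tup1 KV = tup1 K2" "tup2 KV = tup2 K2" "omega KV = omega K2" "baire KV = baire K2"
  by (simp_all add: KV_def)

lemma sigma02_coded_L_K2_KV: "sigma02 K2 (coded_L K2)" "sigma02 KV (coded_L KV)"
proof -
  let ?F = "\<lambda>c. Some (\<lambda>n. if n = 0 then c (8 * c 3 + 1 + (if c 0 = 0 then 0 else 4)) else 0)"
  have id: "realizable KV Some"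
    using realizable_KV_reindex[OF computable_id] by simp
  have tup2: "realizable KV (\<lambda>c. Some (tup2 KV c))"
    using realizable_KV_reindex[of "\<lambda>n. 2 * n + 1"] computable_intros by (simp add: KV_def K2_def)
  have F: "realizes (prod_space K2 (omega K2) (prod_space K2 (baire K2) (omega K2))) (omega K2) ?F
      (\<lambda>(i, x, k). half i x k)"
    unfolding realizes_def
  proof (intro allI impI)
    fix p :: "nat \<Rightarrow> nat" and z :: "nat \<times> (nat \<Rightarrow> nat) \<times> nat"
    assume "prod_space K2 (omega K2) (prod_space K2 (baire K2) (omega K2)) p = Some z"
    then obtain i x k where z: "z = (i, x, k)" and "omega K2 (tup1 K2 p) = Some i"
      "baire K2 (tup1 K2 (tup2 K2 p)) = Some x" "omega K2 (tup2 K2 (tup2 K2 p)) = Some k"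
      by (auto simp: prod_space_def split: option.splits)
    then have i: "i = p 0" and x: "x = (\<lambda>n. p (4 * n + 1))" and "k = p (Suc (Suc (Suc 0)))"
      by (auto simp: K2_def split: if_splits)
    then have k: "k = p 3" by (simp only: numeral_3_eq_3)
    have "half i x k = p (8 * p 3 + 1 + (if p 0 = 0 then 0 else 4))"
      unfolding half_def i x k by simp
    then show "\<exists>q. ?F p = Some q \<and> omega K2 q = Some (case z of (i, x, k) \<Rightarrow> half i x k)"
      unfolding z by (simp add: K2_def)
  qed
  have "omega K2 (\<lambda>k. if k = 0 then n else 0) = Some n" for n by (simp add: K2_def)
  then have omega: "points (omega K2) = UNIV" unfolding ran_def by blast
  have K2: "realizable K2 Some" "realizable K2 (\<lambda>c. Some (tup2 K2 c))" "realizable K2 ?F"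
    using id tup2 realizable_KV_half realizable_K2_of_KV unfolding KV_simps by blast+
  show "sigma02 K2 (coded_L K2)"
    by (rule sigma02_coded_L[OF K2 F omega tupling_K2(2)])
  have "realizes (prod_space KV (omega KV) (prod_space KV (baire KV) (omega KV))) (omega KV) ?F
      (\<lambda>(i, x, k). half i x k)"
    using F unfolding prod_space_def KV_simps .
  then show "sigma02 KV (coded_L KV)"
    using omega by (intro sigma02_coded_L[OF id tup2 realizable_KV_half _ _ tupling_KV(2)])
      (simp_all only: KV_simps)
qed

section \<open>Irreducibility by continuity\<close>

text \<open>
  Each value of \<open>p * x\<close> is determined by the queries up to the first one that is answered, hence by
  a finite part of \<open>x\<close>.
\<close>

lemma k2_app_continuous:
  assumes "k2_app p x = Some y"
  shows "\<exists>m. \<forall>x' y'. (\<forall>i<m. x' i = x i) \<longrightarrow> k2_app p x' = Some y' \<longrightarrow> (\<forall>j<M. y' j = y j)"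
proof (induction M)
  case (Suc M)
  then obtain m where m: "\<And>x' y'. (\<forall>i<m. x' i = x i) \<Longrightarrow> k2_app p x' = Some y' \<Longrightarrow> \<forall>j<M. y' j = y j"
    by blast
  define k where "k = (LEAST k. p (k2_query x M k) > 0)"
  have ex: "\<exists>k. p (k2_query x M k) > 0" and y: "y M = p (k2_query x M k) - 1"
    using assms by (auto simp: k2_app_def k_def split: if_splits)
  have "y' M = y M" if "\<forall>i<k. x' i = x i" "k2_app p x' = Some y'" for x' y'
  proof -
    have query: "k2_query x' M l = k2_query x M l" if "l \<le> k" for l
    proof -
      have "map x' [0..<l] = map x [0..<l]" using that \<open>\<forall>i<k. x' i = x i\<close> by simp
      then show ?thesis unfolding k2_query_def by (simp only:)
    qed
    have "(LEAST l. p (k2_query x' M l) > 0) = k"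
    proof (rule Least_equality)
      show "p (k2_query x' M k) > 0" using LeastI_ex[OF ex] query[of k] by (simp add: k_def)
      show "k \<le> l" if "p (k2_query x' M l) > 0" for l
      proof (rule ccontr)
        assume "\<not> k \<le> l"
        then have "p (k2_query x M l) > 0" "l < k" using that query[of l] by simp_all
        then show False unfolding k_def using not_less_Least by blast
      qed
    qed
    then show ?thesis using that(2) query[of k] y by (auto simp: k2_app_def split: if_splits)
  qed
  then have "\<forall>x' y'. (\<forall>i<max m k. x' i = x i) \<longrightarrow> k2_app p x' = Some y' \<longrightarrow> (\<forall>j<Suc M. y' j = y j)"
    using m by (metis less_Suc_eq max.strict_coboundedI1 max.strict_coboundedI2)
  then show ?case by blast
qed simp

text \<open>
  The map \<open>h\<close> renames points, which lets the same argument serve \<^const>\<open>L\<close> and \<^const>\<open>coded_L\<close>. The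
  origin has a name with either witness; the reduction turns these into two bounds on the support of
  \<open>\<phi> (h zero)\<close>, and \<open>N\<close> is their maximum. Translating the name \<open>\<langle>N, \<phi> (h zero)\<rangle>\<close> back commits to
  a witness \<open>i\<close>, on the evidence of finitely many values. Now perturb the origin far out in the half
  that \<open>i\<close> declares to be zero. The witness \<open>1 - i\<close> is still correct for the perturbed point \<open>z\<close>,
  and by continuity it yields the same bound as before, so that \<open>\<langle>N, \<phi> (h z)\<rangle>\<close> is a valid name;
  again by continuity it is translated back to the witness \<open>i\<close>, which is now wrong.
\<close>

lemma not_reducible_Fin_K2:
  fixes h :: "(nat \<Rightarrow> nat) \<Rightarrow> 'a"
  assumes "inj h" and X: "\<And>p. X p = Some (h p)"
    and A: "\<And>c a. A c = Some a \<longleftrightarrow> (\<exists>i. omega K2 (tup1 K2 c) = Some i \<and> a = h (tup2 K2 c) \<and>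
              (\<forall>k. half i (tup2 K2 c) k = 0))"
  shows "\<not> many_one_reducible K2 A X (Fin K2) (baire K2)"
proof
  assume "many_one_reducible K2 A X (Fin K2) (baire K2)"
  then obtain \<phi> rm rp where phi: "morphism K2 X (baire K2) \<phi>"
    and r: "realizable K2 rm" "realizable K2 rp"
    and rm: "\<And>p x. A p = Some x \<Longrightarrow> \<exists>q. rm p = Some q \<and> Fin K2 q = Some (\<phi> x)"
    and rp: "\<And>p q x. x \<in> points A \<Longrightarrow> X p = Some x \<Longrightarrow> Fin K2 q = Some (\<phi> x) \<Longrightarrow>
               \<exists>s. rp (tup K2 p q) = Some s \<and> A s = Some x"
    unfolding many_one_reducible_def by blast
  obtain a b c where F: "\<And>p. k2_app a p = Some (\<phi> (h p))"
    and rm_eq: "rm = k2_app b" and rp_eq: "rp = k2_app c"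
    using phi r X by (auto simp: morphism_def realizes_def K2_def)
  define nm :: "nat \<Rightarrow> nat \<Rightarrow> nat" where "nm n = (\<lambda>k. if k = 0 then n else 0)" for n
  have Fin_iff: "Fin K2 q = Some y \<longleftrightarrow> (\<forall>k>0. tup1 K2 q k = 0) \<and> tup2 K2 q = y \<and> (\<forall>m\<ge>q 0. y m = 0)" for q y
    by (auto simp: Fin_def K2_def split: option.splits)
  have Fin_tup: "Fin K2 (tup K2 (nm n) y) = Some y" if "\<forall>m\<ge>n. y m = 0" for n y
    using that by (auto simp: Fin_def K2_def nm_def)
  have A_tup: "A (tup K2 (nm i) z) = Some (h z)" if "\<forall>k. half i z k = 0" for i z
    unfolding A tupling_K2 using that by (auto simp: K2_def nm_def)
  define zero where "zero = (\<lambda>_::nat. 0::nat)"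
  have half_zero: "half i zero k = 0" for i k by (simp add: half_def zero_def)
  have "\<exists>q. rm (tup K2 (nm i) zero) = Some q \<and> Fin K2 q = Some (\<phi> (h zero))" for i
    using rm[OF A_tup] half_zero by blast
  then obtain w where w: "\<And>i. rm (tup K2 (nm i) zero) = Some (w i)" "\<And>i. Fin K2 (w i) = Some (\<phi> (h zero))"
    by metis
  define N where "N = max (w 0 0) (w 1 0)"
  define W where "W = tup K2 (nm N) (\<phi> (h zero))"
  have "\<forall>m\<ge>N. \<phi> (h zero) m = 0" using w(2)[of 0] unfolding Fin_iff N_def by simp
  then have "Fin K2 W = Some (\<phi> (h zero))" unfolding W_def by (rule Fin_tup)
  moreover have "h zero \<in> points A" using A_tup[of 0 zero] half_zero by (auto simp: ran_def)
  ultimately obtain s where s: "rp (tup K2 zero W) = Some s" using rp X by blast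
  define i :: nat where "i = (if s 0 = 0 then 0 else 1)"
  have "k2_app c (tup K2 zero W) = Some s" using s unfolding rp_eq .
  from k2_app_continuous[OF this, of 1] obtain m1 where
    m1: "\<And>x' y'. \<forall>j<m1. x' j = tup K2 zero W j \<Longrightarrow> k2_app c x' = Some y' \<Longrightarrow> y' 0 = s 0"
    by (meson less_one)
  from k2_app_continuous[OF F[of zero], of m1] obtain m2 where
    m2: "\<And>x'. \<forall>j<m2. x' j = zero j \<Longrightarrow> \<forall>j<m1. \<phi> (h x') j = \<phi> (h zero) j"
    using F by blast
  have "k2_app b (tup K2 (nm (1 - i)) zero) = Some (w (1 - i))" using w(1) unfolding rm_eq .
  from k2_app_continuous[OF this, of 1] obtain m3 where
    m3: "\<And>x' y'. \<forall>j<m3. x' j = tup K2 (nm (1 - i)) zero j \<Longrightarrow> k2_app b x' = Some y' \<Longrightarrow>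
      y' 0 = w (1 - i) 0"
    by (meson less_one)
  \<comment> \<open>The place of the perturbation lies beyond all three moduli, in the half selected by \<open>i\<close>.\<close>
  define z where "z = (\<lambda>k. if k = 2 * (m1 + m2 + m3) + i then 1 else 0 :: nat)"
  have z_zero: "z j = zero j" if "j < m1 \<or> j < m2 \<or> j < m3" for j
    using that by (auto simp: z_def zero_def)
  have "Suc (2 * k) \<noteq> 2 * n" "2 * k \<noteq> Suc (2 * n)" for k n :: nat by presburger+
  then have half_z: "half (1 - i) z k = 0" for k
    unfolding half_def z_def i_def by (cases "s 0 = 0") (simp_all del: distrib_left_numeral)
  then obtain v where v: "rm (tup K2 (nm (1 - i)) z) = Some v" "Fin K2 v = Some (\<phi> (h z))"
    using rm[OF A_tup] by blast
  have "v 0 = w (1 - i) 0"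
  proof (rule m3[OF _ v(1)[unfolded rm_eq]], intro allI impI)
    fix j assume "j < m3"
    then have "j div 2 < m3" by linarith
    then show "tup K2 (nm (1 - i)) z j = tup K2 (nm (1 - i)) zero j"
      using z_zero[of "j div 2"] by (simp add: K2_def)
  qed
  then have "v 0 \<le> N" by (simp add: N_def i_def)
  then have "\<forall>m\<ge>N. \<phi> (h z) m = 0" using v(2) unfolding Fin_iff by simp
  then have "Fin K2 (tup K2 (nm N) (\<phi> (h z))) = Some (\<phi> (h z))" by (rule Fin_tup)
  moreover have "h z \<in> points A" using A_tup[of "1 - i" z] half_z by (auto simp: ran_def)
  ultimately obtain s' where s': "rp (tup K2 z (tup K2 (nm N) (\<phi> (h z)))) = Some s'" "A s' = Some (h z)"
    using rp X by blast
  have "s' 0 = s 0"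
  proof (rule m1[OF _ s'(1)[unfolded rp_eq]], intro allI impI)
    fix j assume "j < m1"
    moreover have "\<forall>j<m1. \<phi> (h z) j = \<phi> (h zero) j" using m2 z_zero by blast
    moreover have "(j div 2) div 2 < m1" "j div 2 < m1" using \<open>j < m1\<close> by linarith+
    ultimately show "tup K2 z (tup K2 (nm N) (\<phi> (h z))) j = tup K2 zero W j"
      using z_zero[of "j div 2"] by (simp add: K2_def W_def)
  qed
  then obtain i' where i': "i' = s 0" "\<forall>k. half i' z k = 0"
    using s'(2) \<open>inj h\<close> unfolding A by (auto simp: K2_def inj_eq split: if_splits)
  have "half i' z (m1 + m2 + m3) = 1" using i'(1) by (simp add: half_def z_def i_def)
  then show False using i'(2) by simp
qed

text \<open>
  The two systems differ only in that the realizers of the one are fewer, so irreducibility passes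
  from the continuous to the computable setting.
\<close>

lemma many_one_reducible_K2_of_KV:
  assumes "many_one_reducible KV A X B Y"
  shows "many_one_reducible K2 A X B Y"
proof -
  obtain \<phi> rm rp where "morphism KV X Y \<phi>" "realizable KV rm" "realizable KV rp"
     "\<forall>x \<in> points X. x \<in> points A \<longleftrightarrow> \<phi> x \<in> points B"
     "\<forall>p x. A p = Some x \<longrightarrow> (\<exists>q. rm p = Some q \<and> B q = Some (\<phi> x))"
     "\<forall>p q x. x \<in> points A \<longrightarrow> X p = Some x \<longrightarrow> B q = Some (\<phi> x) \<longrightarrow>
           (\<exists>s. rp (tup K2 p q) = Some s \<and> A s = Some x)"
    using assms unfolding many_one_reducible_def KV_simps by blast
  moreover from this(1) have "morphism K2 X Y \<phi>"
    unfolding morphism_def using realizable_K2_of_KV by blast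
  ultimately show ?thesis
    unfolding many_one_reducible_def using realizable_K2_of_KV by blast
qed

lemma K2_not_reducible:
  "\<not> many_one_reducible K2 (coded_L K2) (baire K2) (Fin K2) (baire K2)"
  "\<not> many_one_reducible K2 (L K2) (baire2 K2) (Fin K2) (baire K2)"
proof -
  show "\<not> many_one_reducible K2 (coded_L K2) (baire K2) (Fin K2) (baire K2)"
    by (rule not_reducible_Fin_K2[where h = "\<lambda>p. p"])
      (auto simp: coded_L_eq_Some_iff, auto simp: K2_def)
  show "\<not> many_one_reducible K2 (L K2) (baire2 K2) (Fin K2) (baire K2)"
  proof (rule not_reducible_Fin_K2[where h = "\<lambda>p. (tup1 K2 p, tup2 K2 p)"])
    show "inj (\<lambda>p. (tup1 K2 p, tup2 K2 p))"
      by (rule injI) (metis prod.inject tupling_K2(3))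
    show "baire2 K2 p = Some (tup1 K2 p, tup2 K2 p)" for p
      by (simp add: prod_space_def K2_def)
    show "L K2 c = Some a \<longleftrightarrow> (\<exists>i. omega K2 (tup1 K2 c) = Some i \<and>
        a = (tup1 K2 (tup2 K2 c), tup2 K2 (tup2 K2 c)) \<and> (\<forall>k. half i (tup2 K2 c) k = 0))" for c a
      by (auto simp: L_def prod_space_def K2_def half_def fun_eq_iff)
  qed
qed

lemma KV_not_reducible:
  "\<not> many_one_reducible KV (coded_L KV) (baire KV) (Fin KV) (baire KV)"
  "\<not> many_one_reducible KV (L KV) (baire2 KV) (Fin KV) (baire KV)"
proof -
  have "coded_L KV = coded_L K2" "L KV = L K2" "Fin KV = Fin K2" "baire2 KV = baire2 K2"
    unfolding coded_L_def witnessed_union_def L_def Fin_def prod_space_def KV_simps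
    by (rule refl)+
  then show "\<not> many_one_reducible KV (coded_L KV) (baire KV) (Fin KV) (baire KV)"
    "\<not> many_one_reducible KV (L KV) (baire2 KV) (Fin KV) (baire KV)"
    using K2_not_reducible many_one_reducible_K2_of_KV unfolding KV_simps by metis+
qed

section \<open>Irreducibility by diagonalization\<close>

text \<open>
  The hypotheses describe points \<open>pt a\<close> with computable names \<open>S a\<close> for which the witness 0 is
  wrong exactly if program \<open>a\<close> halts on input \<open>a\<close> with output zero, and a nonzero witness is wrong
  exactly if it halts with positive output. Let \<open>g a\<close> feed both witnesses for \<open>S a\<close> to the
  reduction, add the two bounds so obtained, translate the resulting name back, and return the
  witness. Consider an index \<open>d\<close> of \<open>g\<close>. If \<open>g d\<close> were undefined, both witnesses would be correct, and
  every stage of \<open>g d\<close> would be defined after all. If \<open>g d\<close> is defined, one of the two witnesses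
  is still correct, so that the sum of the bounds is a bound and \<open>g d\<close> is a correct witness; but
  the output of program \<open>d\<close> on \<open>d\<close> rules out precisely the witness that it names.
\<close>

lemma not_reducible_Fin_K1:
  assumes S: "computable S"
    and X: "\<And>a. X (S a) = Some (pt a)"
    and A0: "\<And>a. phi a a \<noteq> Some 0 \<Longrightarrow> A (code_pair 0 (S a)) = Some (pt a)"
    and A1: "\<And>a. (\<forall>v. phi a a \<noteq> Some (Suc v)) \<Longrightarrow> A (code_pair 1 (S a)) = Some (pt a)"
    and side0: "\<And>a s. A s = Some (pt a) \<Longrightarrow> left s = 0 \<Longrightarrow> phi a a \<noteq> Some 0"
    and side1: "\<And>a s v. A s = Some (pt a) \<Longrightarrow> left s \<noteq> 0 \<Longrightarrow> phi a a \<noteq> Some (Suc v)"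
  shows "\<not> many_one_reducible K1 A X (Fin K1) (baire K1)"
proof
  assume "many_one_reducible K1 A X (Fin K1) (baire K1)"
  then obtain \<phi> rm rp where phi: "morphism K1 X (baire K1) \<phi>"
    and r: "realizable K1 rm" "realizable K1 rp"
    and rm: "\<And>p x. A p = Some x \<Longrightarrow> \<exists>q. rm p = Some q \<and> Fin K1 q = Some (\<phi> x)"
    and rp: "\<And>p q x. x \<in> points A \<Longrightarrow> X p = Some x \<Longrightarrow> Fin K1 q = Some (\<phi> x) \<Longrightarrow>
               \<exists>s. rp (tup K1 p q) = Some s \<and> A s = Some x"
    unfolding many_one_reducible_def by blast
  obtain F where F: "realizable K1 F"
    "\<And>p x. X p = Some x \<Longrightarrow> \<exists>q. F p = Some q \<and> baire K1 q = Some (\<phi> x)"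
    using phi unfolding morphism_def realizes_def by blast
  define g where "g a = Option.bind (rm (code_pair 0 (S a))) (\<lambda>w0.
      Option.bind (rm (code_pair 1 (S a))) (\<lambda>w1. Option.bind (F (S a)) (\<lambda>q.
      Option.bind (rp (code_pair (S a) (code_pair (left w0 + left w1) q))) (\<lambda>s. Some (left s)))))" for a
  have pc: "partial_computable rm" "partial_computable rp" "partial_computable F"
    using r F(1) by (simp_all add: K1_def)
  have "partial_computable g"
    unfolding g_def
    by (intro partial_computable_bind partial_computable_Some pc[THEN partial_computable_compose]
        computable_intros computable_compose[OF S])
  then obtain d where d: "g = phi d" using partial_computable_iff_index by blast
  obtain q where q: "F (S d) = Some q" "baire K1 q = Some (\<phi> (pt d))" using F(2)[OF X] by blast
  have Fin_iff: "Fin K1 w = Some y \<longleftrightarrow> baire K1 (right w) = Some y \<and> (\<forall>m\<ge>left w. y m = 0)" for w y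
    by (auto simp: Fin_def K1_def split: option.splits if_splits)
  have answer: "\<exists>s. rp (code_pair (S d) (code_pair (left w0 + left w1) q)) = Some s \<and> A s = Some (pt d)"
    if "pt d \<in> points A" "Fin K1 w0 = Some (\<phi> (pt d)) \<or> Fin K1 w1 = Some (\<phi> (pt d))" for w0 w1
  proof -
    have "Fin K1 (code_pair (left w0 + left w1) q) = Some (\<phi> (pt d))"
      using that(2) q(2) by (auto simp: Fin_iff)
    then show ?thesis using rp[OF that(1) X] by (simp add: K1_def)
  qed
  show False
  proof (cases "phi d d")
    case None
    then have A: "A (code_pair 0 (S d)) = Some (pt d)" "A (code_pair 1 (S d)) = Some (pt d)"
      using A0[of d] A1[of d] by simp_all
    obtain w0 w1 where w: "rm (code_pair 0 (S d)) = Some w0" "Fin K1 w0 = Some (\<phi> (pt d))"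
      "rm (code_pair 1 (S d)) = Some w1"
      using rm[OF A(1)] rm[OF A(2)] by blast
    have "pt d \<in> points A" using A(1) by (auto simp: ran_def)
    then obtain s where "rp (code_pair (S d) (code_pair (left w0 + left w1) q)) = Some s"
      using answer w(2) by blast
    then have "g d \<noteq> None" using w q by (simp add: g_def)
    then show False using None d by simp
  next
    case (Some u)
    then have "g d = Some u" using d by simp
    then obtain w0 w1 s where w: "rm (code_pair 0 (S d)) = Some w0" "rm (code_pair 1 (S d)) = Some w1"
      and s: "rp (code_pair (S d) (code_pair (left w0 + left w1) q)) = Some s" "u = left s"
      using q(1) by (auto simp: g_def bind_eq_Some_conv)
    have "pt d \<in> points A \<and> (Fin K1 w0 = Some (\<phi> (pt d)) \<or> Fin K1 w1 = Some (\<phi> (pt d)))"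
    proof (cases u)
      case 0
      then have "A (code_pair 1 (S d)) = Some (pt d)" using Some by (intro A1) simp
      then show ?thesis using rm[of "code_pair 1 (S d)"] w(2) by (auto simp: ran_def)
    next
      case (Suc v)
      then have "A (code_pair 0 (S d)) = Some (pt d)" using Some by (intro A0) simp
      then show ?thesis using rm[of "code_pair 0 (S d)"] w(1) by (auto simp: ran_def)
    qed
    then have "A s = Some (pt d)" using answer[of w0 w1] s(1) by auto
    then show False using side0 side1 Some s(2) by (metis not0_implies_Suc)
  qed
qed

definition halts_zero :: "nat \<Rightarrow> nat \<Rightarrow> nat" where
  "halts_zero a s = (if timed_eval a a s = 1 then 1 else 0)"

text \<open>
  Once the computation has ended, \<^const>\<open>timed_eval\<close> is the successor of the output, so this is
  positive exactly at the stages where a positive output has appeared.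
\<close>

definition halts_pos :: "nat \<Rightarrow> nat \<Rightarrow> nat" where
  "halts_pos a s = timed_eval a a s - 1"

lemma halts_zero_eq_0_iff: "(\<forall>s. halts_zero a s = 0) \<longleftrightarrow> phi a a \<noteq> Some 0"
  by (auto simp: halts_zero_def phi_eq_Some_iff)

lemma halts_pos_eq_0_iff: "(\<forall>s. halts_pos a s = 0) \<longleftrightarrow> (\<forall>v. phi a a \<noteq> Some (Suc v))"
proof -
  have "n - 1 = 0 \<longleftrightarrow> (\<forall>v. n \<noteq> Suc (Suc v))" for n :: nat by presburger
  then show ?thesis unfolding halts_pos_def phi_eq_Some_iff by blast
qed

lemma computable_halts:
  "computable (\<lambda>z. halts_zero (left z) (right z))" "computable (\<lambda>z. halts_pos (left z) (right z))"
  unfolding halts_zero_def halts_pos_def by (intro computable_timed_eval computable_intros)+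

lemma computable_index:
  assumes "computable (\<lambda>z. f (left z) (right z))"
  obtains S where "computable S" "\<And>a. baire K1 (S a) = Some (f a)"
proof -
  obtain S where "computable S" "\<And>a n. phi (S a) n = Some (f a n)"
    using uniform_index[OF partial_computable_Some[OF assms]] by auto
  then show ?thesis using that by (auto simp: K1_def)
qed

lemma K1_not_reducible_L: "\<not> many_one_reducible K1 (L K1) (baire2 K1) (Fin K1) (baire K1)"
proof -
  obtain S0 where S0: "computable S0" "\<And>a. baire K1 (S0 a) = Some (halts_zero a)"
    using computable_index[OF computable_halts(1)] by blast
  obtain S1 where S1: "computable S1" "\<And>a. baire K1 (S1 a) = Some (halts_pos a)"
    using computable_index[OF computable_halts(2)] by blast
  have L_iff: "L K1 c = Some (x, y) \<longleftrightarrow> baire2 K1 (right c) = Some (x, y) \<and>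
      (if left c = 0 then \<forall>s. x s = 0 else \<forall>s. y s = 0)" for c x y
    by (auto simp: L_def K1_def fun_eq_iff split: option.splits if_splits)
  have "tup1 K1 (code_pair p q) = p" "tup2 K1 (code_pair p q) = q" for p q
    by (simp_all add: K1_def)
  then have X: "baire2 K1 (code_pair (S0 a) (S1 a)) = Some (halts_zero a, halts_pos a)" for a
    by (simp add: prod_space_def S0(2) S1(2))
  show ?thesis
    by (rule not_reducible_Fin_K1[where S = "\<lambda>a. code_pair (S0 a) (S1 a)"
          and pt = "\<lambda>a. (halts_zero a, halts_pos a)"])
      (auto simp: L_iff X halts_zero_eq_0_iff halts_pos_eq_0_iff computable_pair S0 S1)
qed

lemma K1_not_reducible_coded_L:
  "\<not> many_one_reducible K1 (coded_L K1) (baire K1) (Fin K1) (baire K1)"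
proof -
  let ?z = "\<lambda>a n. if n mod 2 = 0 then halts_zero a (n div 2) else halts_pos a (n div 2)"
  have "computable (\<lambda>z. ?z (left z) (right z))"
    by (intro computable_compose2[OF computable_halts(1)] computable_compose2[OF computable_halts(2)]
        computable_intros)
  then obtain S where S: "computable S" "\<And>a. baire K1 (S a) = Some (?z a)"
    using computable_index[where f = ?z] by blast
  have half_z: "half i (?z a) k = (if i = 0 then halts_zero a k else halts_pos a k)" for i a k
    by (simp add: half_def)
  have coded_iff: "coded_L K1 c = Some x \<longleftrightarrow>
      baire K1 (right c) = Some x \<and> (\<forall>k. half (left c) x k = 0)" for c x
    unfolding coded_L_eq_Some_iff by (auto simp: K1_def)
  show ?thesis
  proof (rule not_reducible_Fin_K1[where S = S and pt = ?z])
    fix a s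
    show "phi a a \<noteq> Some 0 \<Longrightarrow> coded_L K1 (code_pair 0 (S a)) = Some (?z a)"
      unfolding coded_iff half_z using S(2) by (simp add: halts_zero_eq_0_iff)
    show "\<forall>v. phi a a \<noteq> Some (Suc v) \<Longrightarrow> coded_L K1 (code_pair 1 (S a)) = Some (?z a)"
      unfolding coded_iff half_z using S(2) by (simp add: halts_pos_eq_0_iff)
    show "coded_L K1 s = Some (?z a) \<Longrightarrow> left s = 0 \<Longrightarrow> phi a a \<noteq> Some 0"
      unfolding coded_iff half_z by (simp add: halts_zero_eq_0_iff)
    show "coded_L K1 s = Some (?z a) \<Longrightarrow> left s \<noteq> 0 \<Longrightarrow> phi a a \<noteq> Some (Suc v)" for v
      unfolding coded_iff half_z by (simp add: halts_pos_eq_0_iff)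
  qed (use S in auto)
qed

theorem theorem5p8:
  shows
   "(\<not> (\<forall>A. sigma02 K1 A \<longrightarrow> many_one_reducible K1 A (baire K1) (Fin K1) (baire K1)) \<and>
     \<not> many_one_reducible K1 (L K1) (baire2 K1) (Fin K1) (baire K1)) \<and>
    (\<not> (\<forall>A. sigma02 K2 A \<longrightarrow> many_one_reducible K2 A (baire K2) (Fin K2) (baire K2)) \<and>
     \<not> many_one_reducible K2 (L K2) (baire2 K2) (Fin K2) (baire K2)) \<and>
    (\<not> (\<forall>A. sigma02 KV A \<longrightarrow> many_one_reducible KV A (baire KV) (Fin KV) (baire KV)) \<and>
     \<not> many_one_reducible KV (L KV) (baire2 KV) (Fin KV) (baire KV))"
  using sigma02_coded_L_K1 K1_not_reducible_coded_L K1_not_reducible_L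
    sigma02_coded_L_K2_KV K2_not_reducible KV_not_reducible
  by blast

end
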